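(* Suppose $X\subset\mathrm{Rat}_+$ is non-degenerate. Let $\Lambda$ be a topological space and let $m$ be a $\sigma$-finite Borel measure on $\Lambda$. Let $I=[a,b)$ be an interval on the real line, possibly $I=[a,\infty)$. Suppose $\Phi:\Lambda\times I\to\mathrm{MRDS}(X)$, written $\Phi(\lambda,s)=\tau^{\lambda,s}$, satisfies the following three conditions. (i) $\Phi$ is continuous and the associated directed graphs $(V,E)$ of $\tau^{\lambda,s}$ are identical for all $(\lambda,s)\in\Lambda\times I$. (ii) $\operatorname{supp}\tau_e^{\lambda,s_1}\subset\mathrm{int}(\operatorname{supp}\tau_e^{\lambda,s_2})$ for each $e\in E$, $\lambda\in\Lambda$ and $s_1<s_2$ in $I$, where $\mathrm{int}$ denotes the set of all interior points with respect to the topological space $X$. (iii) $\tau^{\lambda,s}$ has at least one attracting minimal set for each $(\lambda,s)\in\Lambda\times I$. For each $s\in I$, let $\mathrm{Bif}_s$ be the set of all $\lambda\in\Lambda$ such that $\tau^{\lambda,s}$ is not mean stable. For each $\lambda\in\Lambda$, let $\mathrm{Bif}^\lambda$ be the set of all $s\in I$ such that $\tau^{\lambda,s}$ is not mean stable. Suppose that there exists $\alpha\in\mathbb N$ such that $\#\mathrm{Bif}^\lambda\le\alpha$ for each $\lambda\in\Lambda$. Then $m(\mathrm{Bif}_s)=0$ for all but countably many $s\in I$.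
   Context: Let $d$ be the spherical distance on the Riemann sphere $\widehat{\mathbb C}$. $\mathrm{Rat}_+$ is the space of all rational maps $\widehat{\mathbb C}\to\widehat{\mathbb C}$ of degree two or more, with metric $\kappa(f,g)=\sup_{z\in\widehat{\mathbb C}}d(f(z),g(z))$. $\mathrm{Poly}\subset\mathrm{Rat}_+$ is the set of polynomial maps of degree two or more. Markov random dynamical system (MRDS): for some $q\in\mathbb N$, a family $\tau=(\tau_{ij})_{i,j=1,\dots,q}$ of regular Borel measures on $\mathrm{Rat}_+$ with $\sum_{j=1}^q\tau_{ij}(\mathrm{Rat}_+)=1$ for all $i$. Its associated directed graph $(V,E)$ has $V=\{1,\dots,q\}$ and $E=\{(i,j)\in V\times V;\tau_{ij}(\mathrm{Rat}_+)>0\}$; for $e=(i,j)\in E$ put $i(e)=i$, $t(e)=j$, $\tau_e=\tau_{ij}$, $\Gamma_e=\operatorname{supp}\tau_e$ (topological support). $S_\tau=(V,E,(\Gamma_e)_{e\in E})$. $\tau$ is irreducible if $(V,E)$ is strongly connected. $\mathrm{MRDS}(X)$ is the set of all irreducible MRDSs $\tau$ such that $\operatorname{supp}\tau_e$ is compact and contained in $X$ for every $e\in E$. Topology on $\mathrm{MRDS}(X)$: $\tau^n\to\tau$ if and only if the associated directed graph of $\tau^n$ equals that of $\tau$, $(V,E)$, for all sufficiently large $n$; $\operatorname{supp}\tau^n_e\to\operatorname{supp}\tau_e$ in the Hausdorff metric for each $e\in E$; and $\tau^n_e\to\tau_e$ in the weak*-topology for each $e\in E$. A word $e=(e_1,\dots,e_N)\in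 E^N$ is admissible if $t(e_n)=i(e_{n+1})$ for $n=1,\dots,N-1$; put $i(e)=i(e_1)$, $t(e)=t(e_N)$. $H_i^j(S_\tau)$ is the set of all compositions $f_N\circ\dots\circ f_1$ with $N\in\mathbb N$, $f_n\in\Gamma_{e_n}$, $(e_1,\dots,e_N)$ admissible, $i(e_1)=i$, $t(e_N)=j$. $F_i(S_\tau)$ is the set of $z\in\widehat{\mathbb C}$ having a neighborhood on which $\bigcup_{j\in V}H_i^j(S_\tau)$ is equicontinuous. Mean stable: there exist $N\in\mathbb N$ and families of non-empty open sets $(U_i)_{i\in V}$, $(W_i)_{i\in V}$ such that (I) $U_i\subset\overline{U_i}\subset W_i\subset\overline{W_i}\subset F_i(S_\tau)$ for each $i$; (II) for each admissible word $e=(e_1,\dots,e_N)$ of length $N$ and all $f_n\in\Gamma_{e_n}$, $\overline{f_N\circ\dots\circ f_1(W_{i(e)})}\subset U_{t(e)}$; (III) for each $z\in\widehat{\mathbb C}$ and $i\in V$ there exist $j\in V$ and $h\in H_i^j(S_\tau)$ with $h(z)\in W_j$. Minimal set of $\tau$: a family $(L_i)_{i\in V}$ of subsets of $\widehat{\mathbb C}$ is forward invariant if $f(L_{i(e)})\subset L_{t(e)}$ for all $e\in E$, $f\in\Gamma_e$. A minimal set is a minimal element, with respect to componentwise inclusion, among the forward invariant families with every $L_i$ non-empty and compact. A minimal set $(L_i)_{i\in V}$ is attracting if there exist $N\in\mathbb N$ and open sets $(U_i)_{i\in V},(W_i)_{i\in V}$ with $L_i\subset U_i\subset\overline{U_i}\subset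 W_i\subset\overline{W_i}\subset F_i(S_\tau)$ for each $i$, and $\overline{f_N\circ\dots\circ f_1(W_{i(e)})}\subset U_{t(e)}$ for each admissible word $e=(e_1,\dots,e_N)$ of length $N$ and all $f_n\in\Gamma_{e_n}$. Non-degenerate: a non-empty $X\subset\mathrm{Rat}_+$ is non-degenerate if $X=A\cap B$ for some open $A\subset\mathrm{Rat}_+$ and closed $B\subset\mathrm{Rat}_+$, and at least one of the following holds. (i) For each $(f_0,z_0)\in X\times\widehat{\mathbb C}$ there exists a holomorphic family $\{g_\theta\}_{\theta\in\Theta}$ of rational maps parametrized by a finite dimensional complex manifold $\Theta$ (i.e. $g_\theta\in\mathrm{Rat}_+$ for each $\theta$ and $(z,\theta)\mapsto g_\theta(z)$ is holomorphic from $\widehat{\mathbb C}\times\Theta$ to $\widehat{\mathbb C}$) with $\{g_\theta;\theta\in\Theta\}\subset X$ such that $g_{\theta_0}=f_0$ for some $\theta_0\in\Theta$ and $\theta\mapsto g_\theta(z_0)$ is non-constant in any neighborhood of $\theta_0$. (ii) $X\subset\mathrm{Poly}$ and for each $(f_0,z_0)\in X\times\mathbb C$ there exists a holomorphic family $\{g_\theta\}_{\theta\in\Theta}$ of rational maps parametrized by a complex manifold $\Theta$ with $\{g_\theta;\theta\in\Theta\}\subset X$ such that $g_{\theta_0}=f_0$ for some $\theta_0\in\Theta$ and $\theta\mapsto g_\theta(z_0)$ is non-constant in any neighborhood of $\theta_0$. *)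

theory Defs
  imports
    "HOL-Analysis.Analysis"
    "HOL-Computational_Algebra.Polynomial"
begin

section \<open>The Riemann sphere with the spherical distance\<close>

datatype riemann_sphere = Pt complex | Infty

text \<open>Inverse stereographic projection onto the unit sphere of \<open>complex \<times> real\<close>; the spherical
  distance is the length of the shorter great-circle arc.\<close>

fun stereo :: "riemann_sphere \<Rightarrow> complex \<times> real" where
  "stereo (Pt z) = ((2 / (1 + (cmod z)\<^sup>2)) *\<^sub>R z, ((cmod z)\<^sup>2 - 1) / ((cmod z)\<^sup>2 + 1))"
| "stereo Infty = (0, 1)"

lemma inner_stereo_self: "inner (stereo p) (stereo p) = 1"
proof (cases p)
  case (Pt z)
  define r where "r = (cmod z)\<^sup>2"
  have "r \<ge> 0" unfolding r_def by simp
  have zz: "inner z z = r" by (simp add: r_def power2_norm_eq_inner)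
  have "inner (stereo p) (stereo p) = (2 / (1 + r)) * ((2 / (1 + r)) * r) + ((r - 1) / (r + 1))\<^sup>2"
    using zz by (simp add: Pt flip: r_def) (simp add: power2_eq_square)
  also have "\<dots> = 1"
    using \<open>r \<ge> 0\<close> by (simp add: field_simps power2_eq_square add_nonneg_eq_0_iff)
  finally show ?thesis .
qed auto

lemma norm_stereo: "norm (stereo p) = 1"
  using inner_stereo_self[of p] by (simp add: norm_eq_sqrt_inner)

lemma stereo_eq_iff: "stereo p = stereo q \<longleftrightarrow> p = q"
proof
  have ne: "stereo (Pt z) \<noteq> (0, 1)" for z
  proof
    assume "stereo (Pt z) = (0, 1)"
    then have "(cmod z)\<^sup>2 - 1 = (cmod z)\<^sup>2 + 1"
      by (auto simp: divide_eq_eq split: if_splits)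
    then show False by simp
  qed
  assume eq: "stereo p = stereo q"
  show "p = q"
  proof (cases p; cases q)
    fix z w assume p: "p = Pt z" and q: "q = Pt w"
    have pos: "1 + (cmod z)\<^sup>2 > 0" "1 + (cmod w)\<^sup>2 > 0"
      by (simp_all add: add_pos_nonneg)
    have "((cmod z)\<^sup>2 - 1) / ((cmod z)\<^sup>2 + 1) = ((cmod w)\<^sup>2 - 1) / ((cmod w)\<^sup>2 + 1)"
      using eq p q by simp
    then have "((cmod z)\<^sup>2 - 1) * ((cmod w)\<^sup>2 + 1) = ((cmod w)\<^sup>2 - 1) * ((cmod z)\<^sup>2 + 1)"
      using pos by (subst (asm) frac_eq_eq) auto
    then have r: "(cmod z)\<^sup>2 = (cmod w)\<^sup>2" by (simp add: algebra_simps)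
    have "(2 / (1 + (cmod z)\<^sup>2)) *\<^sub>R z = (2 / (1 + (cmod w)\<^sup>2)) *\<^sub>R w"
      using eq p q by simp
    then have "z = w" using pos unfolding r by simp
    then show ?thesis using p q by simp
  qed (use eq ne ne[symmetric] in \<open>auto simp del: stereo.simps(1)\<close>)
qed auto

lemma arccos_inner_triangle:
  fixes u v w :: "'a::real_inner"
  assumes "norm u = 1" "norm v = 1" "norm w = 1"
  shows "arccos (inner u w) \<le> arccos (inner u v) + arccos (inner v w)"
proof -
  define a b where "a = arccos (inner u v)" and "b = arccos (inner v w)"
  have le: "\<bar>inner x y\<bar> \<le> 1" if "norm x = 1" "norm y = 1" for x y :: 'a
    using Cauchy_Schwarz_ineq2[of x y] that by simp
  have uv: "\<bar>inner u v\<bar> \<le> 1" and vw: "\<bar>inner v w\<bar> \<le> 1" and uw: "\<bar>inner u w\<bar> \<le> 1"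
    using assms by (auto intro: le)
  have ab: "0 \<le> a" "a \<le> pi" "0 \<le> b" "b \<le> pi" "arccos (inner u w) \<le> pi"
    using uv vw uw by (auto simp: a_def b_def arccos_lbound arccos_ubound abs_le_iff)
  have cos: "cos a = inner u v" "cos b = inner v w"
    using uv vw by (auto simp: a_def b_def abs_le_iff)
  have sin: "sin a = sqrt (1 - (inner u v)\<^sup>2)" "sin b = sqrt (1 - (inner v w)\<^sup>2)"
    using uv vw by (auto simp: a_def b_def abs_le_iff sin_arccos)
  show ?thesis
  proof (cases "a + b \<le> pi")
    case True
    have one: "inner u u = 1" "inner v v = 1" "inner w w = 1"
      using assms by (simp_all flip: power2_norm_eq_inner)
    define u' w' where "u' = u - inner u v *\<^sub>R v" and "w' = w - inner v w *\<^sub>R v"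
    have nu: "(norm u')\<^sup>2 = 1 - (inner u v)\<^sup>2" and nw: "(norm w')\<^sup>2 = 1 - (inner v w)\<^sup>2"
      unfolding power2_norm_eq_inner u'_def w'_def
      using one by (simp_all add: inner_diff inner_commute power2_eq_square)
    have "inner u' w' = inner u w - inner u v * inner v w"
      unfolding u'_def w'_def using one by (simp add: inner_diff inner_commute)
    moreover have "norm u' = sin a" "norm w' = sin b"
      unfolding sin using nu nw by (metis norm_ge_zero real_sqrt_unique)+
    moreover have "\<bar>inner u' w'\<bar> \<le> norm u' * norm w'" by (rule Cauchy_Schwarz_ineq2)
    ultimately have "cos (a + b) \<le> inner u w"
      by (simp add: cos_add cos)
    then have "arccos (inner u w) \<le> arccos (cos (a + b))"
      using uw by (intro arccos_le_arccos) auto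
    also have "\<dots> = a + b" using ab True by (intro arccos_cos) auto
    finally show ?thesis unfolding a_def b_def .
  next
    case False
    then show ?thesis using ab unfolding a_def b_def by linarith
  qed
qed

instantiation riemann_sphere :: metric_space
begin

definition dist_riemann_sphere :: "riemann_sphere \<Rightarrow> riemann_sphere \<Rightarrow> real" where
  "dist_riemann_sphere p q = arccos (inner (stereo p) (stereo q))"

definition uniformity_riemann_sphere :: "(riemann_sphere \<times> riemann_sphere) filter" where
  "uniformity_riemann_sphere = (INF e\<in>{0<..}. principal {(x, y). dist x y < e})"

definition open_riemann_sphere :: "riemann_sphere set \<Rightarrow> bool" where
  "open_riemann_sphere U \<longleftrightarrow>
    (\<forall>x\<in>U. \<forall>\<^sub>F (x', y) in uniformity. x' = x \<longrightarrow> y \<in> U)"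

instance
proof
  fix x y z :: riemann_sphere
  have le: "\<bar>inner (stereo p) (stereo q)\<bar> \<le> 1" for p q
    using Cauchy_Schwarz_ineq2[of "stereo p" "stereo q"] by (simp add: norm_stereo)
  show "(dist x y = 0) = (x = y)"
  proof
    assume "dist x y = 0"
    then have "arccos (inner (stereo x) (stereo y)) = 0" by (simp add: dist_riemann_sphere_def)
    then have "inner (stereo x) (stereo y) = 1"
      using le[of x y] cos_arccos_abs[of "inner (stereo x) (stereo y)"] by simp
    then have "(norm (stereo x - stereo y))\<^sup>2 = 0"
      unfolding power2_norm_eq_inner
      by (simp add: inner_diff inner_stereo_self inner_commute)
    then show "x = y" by (simp add: stereo_eq_iff)
  qed (simp add: dist_riemann_sphere_def inner_stereo_self)
  have "dist y z = dist z y" by (simp add: dist_riemann_sphere_def inner_commute)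
  then show "dist x y \<le> dist x z + dist y z"
    using arccos_inner_triangle[of "stereo x" "stereo z" "stereo y"]
    by (simp add: dist_riemann_sphere_def norm_stereo)
qed (simp_all add: uniformity_riemann_sphere_def open_riemann_sphere_def)

end

lemma dist_sphere_le_pi: "dist p q \<le> pi" for p q :: riemann_sphere
proof -
  have "\<bar>inner (stereo p) (stereo q)\<bar> \<le> 1"
    using Cauchy_Schwarz_ineq2[of "stereo p" "stereo q"] by (simp add: norm_stereo)
  then show ?thesis by (auto simp: dist_riemann_sphere_def abs_le_iff arccos_ubound)
qed


section \<open>Rational maps\<close>

text \<open>The action of \<open>p/q\<close> on the sphere.  The value at infinity is read off from the homogenisation of
  degree \<open>d\<close>, whose coordinates at \<open>[1:0]\<close> are the coefficients of index \<open>d\<close>.\<close>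

fun rational_fun :: "complex poly \<Rightarrow> complex poly \<Rightarrow> riemann_sphere \<Rightarrow> riemann_sphere" where
  "rational_fun p q (Pt z) = (if poly q z = 0 then Infty else Pt (poly p z / poly q z))"
| "rational_fun p q Infty =
    (let d = max (degree p) (degree q)
     in if coeff q d = 0 then Infty else Pt (coeff p d / coeff q d))"

typedef rat_plus =
  "{f. \<exists>p q. coprime p q \<and> max (degree p) (degree q) \<ge> 2 \<and> f = rational_fun p q}"
  morphisms rat_apply Abs_rat_plus
proof
  show "rational_fun (monom 1 2) 1 \<in>
      {f. \<exists>p q. coprime p q \<and> max (degree p) (degree q) \<ge> 2 \<and> f = rational_fun p q}"
    by (intro CollectI exI[of _ "monom 1 2"] exI[of _ 1]) (simp add: degree_monom_eq)
qed

definition Poly_maps :: "rat_plus set" where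
  "Poly_maps = {f. \<exists>p. degree p \<ge> 2 \<and> rat_apply f = rational_fun p 1}"

instantiation rat_plus :: metric_space
begin

definition dist_rat_plus :: "rat_plus \<Rightarrow> rat_plus \<Rightarrow> real" where
  "dist_rat_plus f g = (SUP z. dist (rat_apply f z) (rat_apply g z))"

definition uniformity_rat_plus :: "(rat_plus \<times> rat_plus) filter" where
  "uniformity_rat_plus = (INF e\<in>{0<..}. principal {(x, y). dist x y < e})"

definition open_rat_plus :: "rat_plus set \<Rightarrow> bool" where
  "open_rat_plus U \<longleftrightarrow>
    (\<forall>x\<in>U. \<forall>\<^sub>F (x', y) in uniformity. x' = x \<longrightarrow> y \<in> U)"

instance
proof
  fix f g h :: rat_plus
  have bdd: "bdd_above (range (\<lambda>z. dist (rat_apply f z) (rat_apply g z)))" for f g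
    by (intro bdd_aboveI[of _ pi]) (auto simp: dist_sphere_le_pi)
  have le: "dist (rat_apply f z) (rat_apply g z) \<le> dist f g" for f g z
    unfolding dist_rat_plus_def by (intro cSUP_upper bdd) auto
  show "(dist f g = 0) = (f = g)"
  proof
    assume "dist f g = 0"
    then have "rat_apply f z = rat_apply g z" for z
      using le[of f z g] by (metis dist_le_zero_iff)
    then show "f = g" by (auto simp: rat_apply_inject[symmetric])
  qed (simp add: dist_rat_plus_def)
  show "dist f g \<le> dist f h + dist g h"
    unfolding dist_rat_plus_def[of f g]
  proof (rule cSUP_least)
    fix z
    have "dist (rat_apply f z) (rat_apply g z)
        \<le> dist (rat_apply f z) (rat_apply h z) + dist (rat_apply g z) (rat_apply h z)"
      by (rule dist_triangle2)
    then show "dist (rat_apply f z) (rat_apply g z) \<le> dist f h + dist g h"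
      using le[of f z h] le[of g z h] by linarith
  qed simp
qed (simp_all add: uniformity_rat_plus_def open_rat_plus_def)

end


section \<open>Complex manifolds and holomorphic families\<close>

text \<open>\<open>\<complex>\<^sup>n\<close> is realised inside \<open>nat \<Rightarrow> complex\<close> (with the product topology), so that the dimension
  can be quantified.  A chart is a pair of its domain and its coordinate map.\<close>

definition complex_space :: "nat \<Rightarrow> (nat \<Rightarrow> complex) set" where
  "complex_space n = {v. \<forall>i\<ge>n. v i = 0}"

text \<open>Complex Frechet differentiability at every point of an open subset of \<open>\<complex>\<^sup>n\<close>.\<close>

definition holomorphic_in :: "nat \<Rightarrow> (nat \<Rightarrow> complex) set \<Rightarrow> ((nat \<Rightarrow> complex) \<Rightarrow> complex) \<Rightarrow> bool" where
  "holomorphic_in n U f \<longleftrightarrow>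
    (\<forall>p\<in>U. \<exists>c :: nat \<Rightarrow> complex.
      ((\<lambda>x. cmod (f x - f p - (\<Sum>i<n. c i * (x i - p i))) / (\<Sum>i<n. cmod (x i - p i)))
        \<longlongrightarrow> 0) (at p within U))"

type_synonym 'a chart = "'a set \<times> ('a \<Rightarrow> nat \<Rightarrow> complex)"

definition complex_manifold :: "nat \<Rightarrow> 'a topology \<Rightarrow> 'a chart set \<Rightarrow> bool" where
  "complex_manifold n T \<A> \<longleftrightarrow>
    Hausdorff_space T \<and> second_countable T \<and>
    (\<Union>(U, \<phi>)\<in>\<A>. U) = topspace T \<and>
    (\<forall>(U, \<phi>)\<in>\<A>. openin T U \<and> openin (top_of_set (complex_space n)) (\<phi> ` U) \<and>
      homeomorphic_map (subtopology T U) (top_of_set (\<phi> ` U)) \<phi>) \<and>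
    (\<forall>(U, \<phi>)\<in>\<A>. \<forall>(V, \<psi>)\<in>\<A>. \<forall>i<n.
      holomorphic_in n (\<phi> ` (U \<inter> V)) (\<lambda>x. \<psi> (inv_into U \<phi> x) i))"

definition holomorphic_map ::
  "nat \<Rightarrow> 'a topology \<Rightarrow> 'a chart set \<Rightarrow> nat \<Rightarrow> 'b topology \<Rightarrow> 'b chart set \<Rightarrow> ('a \<Rightarrow> 'b) \<Rightarrow> bool" where
  "holomorphic_map m S \<A> n T \<B> F \<longleftrightarrow>
    continuous_map S T F \<and>
    (\<forall>(U, \<phi>)\<in>\<A>. \<forall>(V, \<psi>)\<in>\<B>. \<forall>i<n.
      holomorphic_in m (\<phi> ` (U \<inter> F -` V)) (\<lambda>x. \<psi> (F (inv_into U \<phi> x)) i))"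

definition prod_atlas :: "nat \<Rightarrow> 'a chart set \<Rightarrow> 'b chart set \<Rightarrow> ('a \<times> 'b) chart set" where
  "prod_atlas m \<A> \<B> =
    {(U \<times> V, \<lambda>(x, y) i. if i < m then \<phi> x i else \<psi> y (i - m)) |U \<phi> V \<psi>.
      (U, \<phi>) \<in> \<A> \<and> (V, \<psi>) \<in> \<B>}"

definition complex_coord :: "complex \<Rightarrow> nat \<Rightarrow> complex" where
  "complex_coord z = (\<lambda>i. if i = 0 then z else 0)"

definition sphere_atlas :: "riemann_sphere chart set" where
  "sphere_atlas =
    {(range Pt, \<lambda>p. case p of Pt z \<Rightarrow> complex_coord z | Infty \<Rightarrow> complex_coord 0),
     (- {Pt 0}, \<lambda>p. case p of Pt z \<Rightarrow> complex_coord (1 / z) | Infty \<Rightarrow> complex_coord 0)}"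

definition holomorphic_family ::
  "nat \<Rightarrow> 'a topology \<Rightarrow> 'a chart set \<Rightarrow> ('a \<Rightarrow> rat_plus) \<Rightarrow> bool" where
  "holomorphic_family n \<Theta> \<A> g \<longleftrightarrow>
    complex_manifold n \<Theta> \<A> \<and>
    holomorphic_map (1 + n) (prod_topology euclidean \<Theta>) (prod_atlas 1 sphere_atlas \<A>)
      1 euclidean sphere_atlas (\<lambda>(z, \<theta>). rat_apply (g \<theta>) z)"

text \<open>A second countable manifold has at most continuum many points, so up to isomorphism every one
  has its points in \<open>nat \<Rightarrow> complex\<close>; its topology \<open>\<Theta>\<close> is unrelated to the topology of that type.\<close>

definition varies_at :: "rat_plus set \<Rightarrow> rat_plus \<Rightarrow> riemann_sphere \<Rightarrow> bool" where
  "varies_at X f0 z0 \<longleftrightarrow>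
    (\<exists>n (\<Theta> :: (nat \<Rightarrow> complex) topology) \<A> g.
      holomorphic_family n \<Theta> \<A> g \<and> g ` topspace \<Theta> \<subseteq> X \<and>
      (\<exists>\<theta>0\<in>topspace \<Theta>. g \<theta>0 = f0 \<and>
        (\<forall>U. openin \<Theta> U \<and> \<theta>0 \<in> U \<longrightarrow> \<not> (\<lambda>\<theta>. rat_apply (g \<theta>) z0) constant_on U)))"

definition non_degenerate :: "rat_plus set \<Rightarrow> bool" where
  "non_degenerate X \<longleftrightarrow>
    X \<noteq> {} \<and> (\<exists>A B. open A \<and> closed B \<and> X = A \<inter> B) \<and>
    ((\<forall>f0\<in>X. \<forall>z0. varies_at X f0 z0) \<or>
     (X \<subseteq> Poly_maps \<and> (\<forall>f0\<in>X. \<forall>z0. varies_at X f0 (Pt z0))))"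


section \<open>Markov random dynamical systems\<close>

definition msupport :: "'a::topological_space measure \<Rightarrow> 'a set" where
  "msupport M = {x. \<forall>U. open U \<and> x \<in> U \<longrightarrow> emeasure M U > 0}"

definition regular_borel_measure :: "'a::topological_space measure \<Rightarrow> bool" where
  "regular_borel_measure M \<longleftrightarrow>
    sets M = sets borel \<and>
    (\<forall>A\<in>sets M.
      emeasure M A = (INF U\<in>{U. A \<subseteq> U \<and> open U}. emeasure M U) \<and>
      emeasure M A = (SUP K\<in>{K. K \<subseteq> A \<and> compact K}. emeasure M K))"

text \<open>Only the entries of \<open>transition\<close> with indices in \<open>{1..num_states}\<close> are meaningful.\<close>

record mrds =
  num_states :: nat
  transition :: "nat \<Rightarrow> nat \<Rightarrow> rat_plus measure"

definition is_mrds :: "mrds \<Rightarrow> bool" where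
  "is_mrds \<tau> \<longleftrightarrow>
    num_states \<tau> \<ge> 1 \<and>
    (\<forall>i\<in>{1..num_states \<tau>}. \<forall>j\<in>{1..num_states \<tau>}. regular_borel_measure (transition \<tau> i j)) \<and>
    (\<forall>i\<in>{1..num_states \<tau>}. (\<Sum>j\<in>{1..num_states \<tau>}. emeasure (transition \<tau> i j) UNIV) = 1)"

definition vertices :: "mrds \<Rightarrow> nat set" where
  "vertices \<tau> = {1..num_states \<tau>}"

definition edges :: "mrds \<Rightarrow> (nat \<times> nat) set" where
  "edges \<tau> = {(i, j). i \<in> vertices \<tau> \<and> j \<in> vertices \<tau> \<and> emeasure (transition \<tau> i j) UNIV > 0}"

definition mrds_graph :: "mrds \<Rightarrow> nat set \<times> (nat \<times> nat) set" where
  "mrds_graph \<tau> = (vertices \<tau>, edges \<tau>)"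

definition edge_measure :: "mrds \<Rightarrow> nat \<times> nat \<Rightarrow> rat_plus measure" where
  "edge_measure \<tau> e = transition \<tau> (fst e) (snd e)"

definition edge_supp :: "mrds \<Rightarrow> nat \<times> nat \<Rightarrow> rat_plus set" where
  "edge_supp \<tau> e = msupport (edge_measure \<tau> e)"

definition irreducible_mrds :: "mrds \<Rightarrow> bool" where
  "irreducible_mrds \<tau> \<longleftrightarrow> (\<forall>i\<in>vertices \<tau>. \<forall>j\<in>vertices \<tau>. (i, j) \<in> (edges \<tau>)\<^sup>*)"

definition MRDS :: "rat_plus set \<Rightarrow> mrds set" where
  "MRDS X = {\<tau>. is_mrds \<tau> \<and> irreducible_mrds \<tau> \<and>
    (\<forall>e\<in>edges \<tau>. compact (edge_supp \<tau> e) \<and> edge_supp \<tau> e \<subseteq> X)}"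


subsection \<open>The topology of \<open>MRDS X\<close>\<close>

definition hausdorff_dist :: "'a::metric_space set \<Rightarrow> 'a set \<Rightarrow> real" where
  "hausdorff_dist A B = max (SUP x\<in>A. infdist x B) (SUP y\<in>B. infdist y A)"

text \<open>The coarsest topology for which the graph is locally constant and, for each edge, the support
  (Hausdorff metric) and the measure (weak* topology) depend continuously on the system; its convergence
  is spelled out in \<open>limitin_mrds_topology\<close> below.\<close>

definition mrds_subbasis :: "rat_plus set \<Rightarrow> mrds set set" where
  "mrds_subbasis X =
    {{\<sigma> \<in> MRDS X. mrds_graph \<sigma> = mrds_graph \<tau>} |\<tau>. \<tau> \<in> MRDS X} \<union>
    {{\<sigma> \<in> MRDS X. e \<in> edges \<sigma> \<and> hausdorff_dist (edge_supp \<sigma> e) (edge_supp \<tau> e) < r} |\<tau> e r.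
      \<tau> \<in> MRDS X \<and> e \<in> edges \<tau>} \<union>
    {{\<sigma> \<in> MRDS X. e \<in> edges \<sigma> \<and>
        \<bar>(\<integral>f. \<phi> f \<partial>edge_measure \<sigma> e) - (\<integral>f. \<phi> f \<partial>edge_measure \<tau> e)\<bar> < r} |\<tau> e (\<phi> :: rat_plus \<Rightarrow> real) r.
      \<tau> \<in> MRDS X \<and> e \<in> edges \<tau> \<and> continuous_on UNIV \<phi> \<and> bounded (range \<phi>)}"

definition mrds_topology :: "rat_plus set \<Rightarrow> mrds topology" where
  "mrds_topology X = topology_generated_by (mrds_subbasis X)"

lemma mrds_subbasisI:
  "\<tau> \<in> MRDS X \<Longrightarrow> {\<sigma> \<in> MRDS X. mrds_graph \<sigma> = mrds_graph \<tau>} \<in> mrds_subbasis X"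
  "\<tau> \<in> MRDS X \<Longrightarrow> e \<in> edges \<tau> \<Longrightarrow>
    {\<sigma> \<in> MRDS X. e \<in> edges \<sigma> \<and> hausdorff_dist (edge_supp \<sigma> e) (edge_supp \<tau> e) < r}
      \<in> mrds_subbasis X"
  "\<tau> \<in> MRDS X \<Longrightarrow> e \<in> edges \<tau> \<Longrightarrow> continuous_on UNIV (\<phi> :: rat_plus \<Rightarrow> real) \<Longrightarrow>
    bounded (range \<phi>) \<Longrightarrow>
    {\<sigma> \<in> MRDS X. e \<in> edges \<sigma> \<and>
      \<bar>(\<integral>f. \<phi> f \<partial>edge_measure \<sigma> e) - (\<integral>f. \<phi> f \<partial>edge_measure \<tau> e)\<bar> < r} \<in> mrds_subbasis X"
  unfolding mrds_subbasis_def
  subgoal by (rule UnI1, rule UnI1, intro CollectI exI conjI; (rule refl | assumption))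
  subgoal by (rule UnI1, rule UnI2, intro CollectI exI conjI; (rule refl | assumption))
  subgoal by (rule UnI2, intro CollectI exI conjI; (rule refl | assumption))
  done

lemma topspace_mrds_topology: "topspace (mrds_topology X) = MRDS X"
  unfolding mrds_topology_def topology_generated_by_topspace
proof (intro equalityI subsetI)
  fix \<tau> assume "\<tau> \<in> \<Union>(mrds_subbasis X)"
  then show "\<tau> \<in> MRDS X" by (auto simp: mrds_subbasis_def)
next
  fix \<tau> assume "\<tau> \<in> MRDS X"
  then show "\<tau> \<in> \<Union>(mrds_subbasis X)" by (intro UnionI[OF mrds_subbasisI(1)]) auto
qed

lemma limitin_topology_generated_by:
  "limitin (topology_generated_by \<S>) f l F \<longleftrightarrow>
    l \<in> \<Union>\<S> \<and> (\<forall>U\<in>\<S>. l \<in> U \<longrightarrow> (\<forall>\<^sub>F x in F. f x \<in> U))"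
proof (intro iffI conjI)
  assume R: "l \<in> \<Union>\<S> \<and> (\<forall>U\<in>\<S>. l \<in> U \<longrightarrow> (\<forall>\<^sub>F x in F. f x \<in> U))"
  have "l \<in> U \<longrightarrow> (\<forall>\<^sub>F x in F. f x \<in> U)" if "generate_topology_on \<S> U" for U
    using that
  proof induction
    case (Int a b)
    then show ?case by (auto simp: eventually_conj)
  next
    case (UN K)
    show ?case
    proof
      assume "l \<in> \<Union>K"
      then obtain k where k: "k \<in> K" "l \<in> k" by blast
      then have "\<forall>\<^sub>F x in F. f x \<in> k" using UN by blast
      then show "\<forall>\<^sub>F x in F. f x \<in> \<Union>K" by (rule eventually_mono) (use k in blast)
    qed
  qed (use R in auto)
  then show "limitin (topology_generated_by \<S>) f l F"
    using R by (auto simp: limitin_def openin_topology_generated_by_iff simp del: Union_iff)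
qed (auto simp: limitin_def topology_generated_by_Basis)

lemma msupport_nonempty:
  assumes "regular_borel_measure M" "emeasure M UNIV > 0"
  shows "msupport M \<noteq> {}"
proof
  assume "msupport M = {}"
  then have "\<forall>x. \<exists>U. open U \<and> x \<in> U \<and> emeasure M U = 0"
    by (auto simp: msupport_def)
  then obtain W where W: "\<And>x. open (W x)" "\<And>x. x \<in> W x" "\<And>x. emeasure M (W x) = 0"
    by metis
  have s: "sets M = sets borel" using assms(1) by (simp add: regular_borel_measure_def)
  have "UNIV \<in> sets M" by (simp add: s)
  then have "emeasure M UNIV = (SUP K\<in>{K. K \<subseteq> UNIV \<and> compact K}. emeasure M K)"
    using assms(1) unfolding regular_borel_measure_def by blast
  then obtain K where K: "compact K" "emeasure M K > 0"
    using assms(2) by (auto simp: less_SUP_iff)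
  obtain D where D: "D \<subseteq> K" "finite D" "K \<subseteq> (\<Union>x\<in>D. W x)"
    using compactE_image[OF K(1), of K W] W by blast
  have "(\<Union>x\<in>D. W x) \<in> null_sets M"
    using D W by (intro null_sets.finite_UN) (auto simp: null_sets_def s)
  moreover have "emeasure M K \<le> emeasure M (\<Union>x\<in>D. W x)"
    using D W by (intro emeasure_mono) (auto simp: s)
  ultimately show False using K by auto
qed

lemma bdd_above_infdist: "bounded A \<Longrightarrow> bdd_above ((\<lambda>x. infdist x B) ` A)"
proof (cases "B = {}")
  case False
  assume "bounded A"
  obtain b where b: "b \<in> B" using False by blast
  obtain d where d: "\<forall>x\<in>A. dist b x \<le> d" using \<open>bounded A\<close> bounded_any_center by metis
  show ?thesis
    by (rule bdd_aboveI2[of _ _ d]) (use b d in \<open>auto intro!: infdist_le2 simp: dist_commute\<close>)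
qed (simp add: infdist_def image_constant_conv)

lemma SUP_infdist_triangle:
  assumes "bounded A" "bounded B" "A \<noteq> {}" "B \<noteq> {}"
  shows "(SUP x\<in>A. infdist x C) \<le> (SUP x\<in>A. infdist x B) + (SUP y\<in>B. infdist y C)"
proof (rule cSUP_least)
  fix x assume x: "x \<in> A"
  have "infdist x C - (SUP y\<in>B. infdist y C) \<le> infdist x B"
    unfolding infdist_notempty[OF \<open>B \<noteq> {}\<close>]
  proof (rule cINF_greatest)
    fix b assume b: "b \<in> B"
    have "infdist x C \<le> infdist b C + dist x b" by (rule infdist_triangle)
    moreover have "infdist b C \<le> (SUP y\<in>B. infdist y C)"
      by (rule cSUP_upper[OF b bdd_above_infdist[OF assms(2)]])
    ultimately show "infdist x C - (SUP y\<in>B. infdist y C) \<le> dist x b" by linarith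
  qed (rule assms)
  moreover have "infdist x B \<le> (SUP x\<in>A. infdist x B)"
    by (rule cSUP_upper[OF x bdd_above_infdist[OF assms(1)]])
  ultimately show "infdist x C \<le> (SUP x\<in>A. infdist x B) + (SUP y\<in>B. infdist y C)" by linarith
qed (rule assms)

lemma hausdorff_dist_triangle:
  assumes "bounded A" "bounded B" "bounded C" "A \<noteq> {}" "B \<noteq> {}" "C \<noteq> {}"
  shows "hausdorff_dist A C \<le> hausdorff_dist A B + hausdorff_dist B C"
  using SUP_infdist_triangle[of A B C] SUP_infdist_triangle[of C B A] assms
  unfolding hausdorff_dist_def by (simp add: max_def) linarith?

lemma hausdorff_dist_nonneg:
  assumes "bounded A" "A \<noteq> {}"
  shows "0 \<le> hausdorff_dist A B"
proof -
  obtain x where x: "x \<in> A" using assms by blast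
  have "0 \<le> infdist x B" by (rule infdist_nonneg)
  also have "\<dots> \<le> (SUP x\<in>A. infdist x B)"
    by (rule cSUP_upper[OF x bdd_above_infdist[OF assms(1)]])
  finally show ?thesis by (simp add: hausdorff_dist_def)
qed

lemma hausdorff_dist_self: "A \<noteq> {} \<Longrightarrow> hausdorff_dist A A = 0"
  by (simp add: hausdorff_dist_def)

lemma MRDS_edge_supp:
  assumes "\<tau> \<in> MRDS X" "e \<in> edges \<tau>"
  shows "bounded (edge_supp \<tau> e)" "edge_supp \<tau> e \<noteq> {}"
proof -
  show "bounded (edge_supp \<tau> e)"
    using assms by (auto simp: MRDS_def intro: compact_imp_bounded)
  have "regular_borel_measure (edge_measure \<tau> e)" "emeasure (edge_measure \<tau> e) UNIV > 0"
    using assms by (auto simp: MRDS_def is_mrds_def edges_def vertices_def edge_measure_def)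
  then show "edge_supp \<tau> e \<noteq> {}"
    unfolding edge_supp_def by (rule msupport_nonempty)
qed

lemma limitin_mrds_topology:
  "limitin (mrds_topology X) T \<tau> F \<longleftrightarrow>
    \<tau> \<in> MRDS X \<and>
    (\<forall>\<^sub>F n in F. T n \<in> MRDS X \<and> mrds_graph (T n) = mrds_graph \<tau>) \<and>
    (\<forall>e\<in>edges \<tau>. ((\<lambda>n. hausdorff_dist (edge_supp (T n) e) (edge_supp \<tau> e)) \<longlongrightarrow> 0) F) \<and>
    (\<forall>e\<in>edges \<tau>. \<forall>\<phi> :: rat_plus \<Rightarrow> real. continuous_on UNIV \<phi> \<and> bounded (range \<phi>) \<longrightarrow>
      ((\<lambda>n. \<integral>f. \<phi> f \<partial>edge_measure (T n) e) \<longlongrightarrow> (\<integral>f. \<phi> f \<partial>edge_measure \<tau> e)) F)"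
  (is "?L \<longleftrightarrow> \<tau> \<in> MRDS X \<and> ?G \<and> ?H \<and> ?W")
proof
  assume L: ?L
  then have \<tau>: "\<tau> \<in> MRDS X"
    using topspace_mrds_topology by (metis limitin_def)
  have ev: "\<forall>\<^sub>F n in F. T n \<in> U" if "U \<in> mrds_subbasis X" "\<tau> \<in> U" for U
    using L that by (auto simp: mrds_topology_def limitin_topology_generated_by)
  have G: ?G
  proof -
    have "\<forall>\<^sub>F n in F. T n \<in> {\<sigma> \<in> MRDS X. mrds_graph \<sigma> = mrds_graph \<tau>}"
      by (rule ev[OF mrds_subbasisI(1)[OF \<tau>]]) (simp add: \<tau>)
    then show ?thesis by simp
  qed
  have H: ?H
  proof
    fix e assume e: "e \<in> edges \<tau>"
    show "((\<lambda>n. hausdorff_dist (edge_supp (T n) e) (edge_supp \<tau> e)) \<longlongrightarrow> 0) F"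
    proof (rule tendstoI)
      fix r :: real assume r: "r > 0"
      have "\<forall>\<^sub>F n in F. T n \<in> {\<sigma> \<in> MRDS X. e \<in> edges \<sigma> \<and>
          hausdorff_dist (edge_supp \<sigma> e) (edge_supp \<tau> e) < r}"
      proof (rule ev[OF mrds_subbasisI(2)[OF \<tau> e]])
        show "\<tau> \<in> {\<sigma> \<in> MRDS X. e \<in> edges \<sigma> \<and>
          hausdorff_dist (edge_supp \<sigma> e) (edge_supp \<tau> e) < r}"
          using \<tau> e r MRDS_edge_supp[OF \<tau> e] by (simp add: hausdorff_dist_self)
      qed
      then show "\<forall>\<^sub>F n in F. dist (hausdorff_dist (edge_supp (T n) e) (edge_supp \<tau> e)) 0 < r"
      proof (rule eventually_mono)
        fix n assume a: "T n \<in> {\<sigma> \<in> MRDS X. e \<in> edges \<sigma> \<and>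
          hausdorff_dist (edge_supp \<sigma> e) (edge_supp \<tau> e) < r}"
        then have "0 \<le> hausdorff_dist (edge_supp (T n) e) (edge_supp \<tau> e)"
          by (intro hausdorff_dist_nonneg MRDS_edge_supp[of _ X]) auto
        then show "dist (hausdorff_dist (edge_supp (T n) e) (edge_supp \<tau> e)) 0 < r"
          using a by simp
      qed
    qed
  qed
  have W: ?W
  proof (intro ballI allI impI tendstoI)
    fix e and \<phi> :: "rat_plus \<Rightarrow> real" and r :: real
    assume e: "e \<in> edges \<tau>" and \<phi>: "continuous_on UNIV \<phi> \<and> bounded (range \<phi>)" and r: "r > 0"
    have "\<forall>\<^sub>F n in F. T n \<in> {\<sigma> \<in> MRDS X. e \<in> edges \<sigma> \<and>
        \<bar>(\<integral>f. \<phi> f \<partial>edge_measure \<sigma> e) - (\<integral>f. \<phi> f \<partial>edge_measure \<tau> e)\<bar> < r}"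
    proof (rule ev[OF mrds_subbasisI(3)[OF \<tau> e]])
      show "\<tau> \<in> {\<sigma> \<in> MRDS X. e \<in> edges \<sigma> \<and>
        \<bar>(\<integral>f. \<phi> f \<partial>edge_measure \<sigma> e) - (\<integral>f. \<phi> f \<partial>edge_measure \<tau> e)\<bar> < r}"
        using \<tau> e r by simp
    qed (use \<phi> in auto)
    then show "\<forall>\<^sub>F n in F. dist (\<integral>f. \<phi> f \<partial>edge_measure (T n) e) (\<integral>f. \<phi> f \<partial>edge_measure \<tau> e) < r"
      by (rule eventually_mono) (simp add: dist_real_def)
  qed
  show "\<tau> \<in> MRDS X \<and> ?G \<and> ?H \<and> ?W" using \<tau> G H W by blast
next
  assume R: "\<tau> \<in> MRDS X \<and> ?G \<and> ?H \<and> ?W"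
  then have \<tau>: "\<tau> \<in> MRDS X" and G: ?G by auto
  have E: "\<forall>\<^sub>F n in F. T n \<in> MRDS X \<and> edges (T n) = edges \<tau>"
    using G by (rule eventually_mono) (simp add: mrds_graph_def)
  have "\<forall>\<^sub>F n in F. T n \<in> U" if U: "U \<in> mrds_subbasis X" and \<tau>U: "\<tau> \<in> U" for U
  proof -
    consider
      (1) \<sigma> where "U = {\<sigma>' \<in> MRDS X. mrds_graph \<sigma>' = mrds_graph \<sigma>}"
    | (2) \<sigma> e r where "\<sigma> \<in> MRDS X" "e \<in> edges \<sigma>"
        "U = {\<sigma>' \<in> MRDS X. e \<in> edges \<sigma>' \<and> hausdorff_dist (edge_supp \<sigma>' e) (edge_supp \<sigma> e) < r}"
    | (3) \<sigma> e and \<phi> :: "rat_plus \<Rightarrow> real" and r where "continuous_on UNIV \<phi>" "bounded (range \<phi>)"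
        "U = {\<sigma>' \<in> MRDS X. e \<in> edges \<sigma>' \<and>
          \<bar>(\<integral>f. \<phi> f \<partial>edge_measure \<sigma>' e) - (\<integral>f. \<phi> f \<partial>edge_measure \<sigma> e)\<bar> < r}"
      using U unfolding mrds_subbasis_def by blast
    then show ?thesis
    proof cases
      case 1
      show ?thesis using G by (rule eventually_mono) (use 1 \<tau>U in auto)
    next
      case 2
      then have e: "e \<in> edges \<tau>" and l: "hausdorff_dist (edge_supp \<tau> e) (edge_supp \<sigma> e) < r"
        using \<tau>U by auto
      have "((\<lambda>n. hausdorff_dist (edge_supp (T n) e) (edge_supp \<tau> e)) \<longlongrightarrow> 0) F"
        using R e by blast
      then have "\<forall>\<^sub>F n in F. hausdorff_dist (edge_supp (T n) e) (edge_supp \<tau> e)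
          < r - hausdorff_dist (edge_supp \<tau> e) (edge_supp \<sigma> e)"
        by (rule order_tendstoD) (use l in simp)
      with E show ?thesis
      proof eventually_elim
        case (elim n)
        then have "hausdorff_dist (edge_supp (T n) e) (edge_supp \<sigma> e)
          \<le> hausdorff_dist (edge_supp (T n) e) (edge_supp \<tau> e)
            + hausdorff_dist (edge_supp \<tau> e) (edge_supp \<sigma> e)"
          using \<tau> e 2 by (intro hausdorff_dist_triangle MRDS_edge_supp[of _ X]) auto
        then show ?case using elim e by (auto simp: 2(3))
      qed
    next
      case 3
      then have e: "e \<in> edges \<tau>"
        and l: "\<bar>(\<integral>f. \<phi> f \<partial>edge_measure \<tau> e) - (\<integral>f. \<phi> f \<partial>edge_measure \<sigma> e)\<bar> < r"
        using \<tau>U by auto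
      have "((\<lambda>n. \<integral>f. \<phi> f \<partial>edge_measure (T n) e) \<longlongrightarrow> (\<integral>f. \<phi> f \<partial>edge_measure \<tau> e)) F"
        using R e 3 by blast
      then have "((\<lambda>n. \<bar>(\<integral>f. \<phi> f \<partial>edge_measure (T n) e) - (\<integral>f. \<phi> f \<partial>edge_measure \<sigma> e)\<bar>) \<longlongrightarrow>
          \<bar>(\<integral>f. \<phi> f \<partial>edge_measure \<tau> e) - (\<integral>f. \<phi> f \<partial>edge_measure \<sigma> e)\<bar>) F"
        by (intro tendsto_intros)
      then have "\<forall>\<^sub>F n in F. \<bar>(\<integral>f. \<phi> f \<partial>edge_measure (T n) e) - (\<integral>f. \<phi> f \<partial>edge_measure \<sigma> e)\<bar> < r"
        by (rule order_tendstoD) (use l in simp)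
      with E show ?thesis by eventually_elim (use e in \<open>auto simp: 3(3)\<close>)
    qed
  qed
  moreover have "\<tau> \<in> \<Union>(mrds_subbasis X)"
    using topspace_mrds_topology[of X] \<tau> by (simp add: mrds_topology_def)
  ultimately show ?L by (simp add: mrds_topology_def limitin_topology_generated_by)
qed


subsection \<open>Dynamics\<close>

definition admissible :: "mrds \<Rightarrow> (nat \<times> nat) list \<Rightarrow> bool" where
  "admissible \<tau> es \<longleftrightarrow>
    es \<noteq> [] \<and> set es \<subseteq> edges \<tau> \<and> (\<forall>n. Suc n < length es \<longrightarrow> snd (es ! n) = fst (es ! Suc n))"

text \<open>\<open>compose_maps [f\<^sub>1, \<dots>, f\<^sub>N] = f\<^sub>N \<circ> \<dots> \<circ> f\<^sub>1\<close>.\<close>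

definition compose_maps :: "rat_plus list \<Rightarrow> riemann_sphere \<Rightarrow> riemann_sphere" where
  "compose_maps fs = fold (\<lambda>f h. rat_apply f \<circ> h) fs id"

definition word_maps :: "mrds \<Rightarrow> (nat \<times> nat) list \<Rightarrow> (riemann_sphere \<Rightarrow> riemann_sphere) set" where
  "word_maps \<tau> es = {compose_maps fs |fs. list_all2 (\<lambda>f e. f \<in> edge_supp \<tau> e) fs es}"

definition H_maps :: "mrds \<Rightarrow> nat \<Rightarrow> nat \<Rightarrow> (riemann_sphere \<Rightarrow> riemann_sphere) set" where
  "H_maps \<tau> i j =
    (\<Union>es\<in>{es. admissible \<tau> es \<and> fst (hd es) = i \<and> snd (last es) = j}. word_maps \<tau> es)"

definition equicontinuous_on ::
  "'a::metric_space set \<Rightarrow> ('a \<Rightarrow> 'b::metric_space) set \<Rightarrow> bool" where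
  "equicontinuous_on U \<F> \<longleftrightarrow>
    (\<forall>x\<in>U. \<forall>\<epsilon>>0. \<exists>\<delta>>0. \<forall>h\<in>\<F>. \<forall>y\<in>U. dist y x < \<delta> \<longrightarrow> dist (h y) (h x) < \<epsilon>)"

definition Fatou :: "mrds \<Rightarrow> nat \<Rightarrow> riemann_sphere set" where
  "Fatou \<tau> i = {z. \<exists>U. open U \<and> z \<in> U \<and> equicontinuous_on U (\<Union>j\<in>vertices \<tau>. H_maps \<tau> i j)}"

definition mean_stable :: "mrds \<Rightarrow> bool" where
  "mean_stable \<tau> \<longleftrightarrow>
    (\<exists>N U W. N \<ge> 1 \<and>
      (\<forall>i\<in>vertices \<tau>. open (U i) \<and> U i \<noteq> {} \<and> open (W i) \<and> W i \<noteq> {}) \<and>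
      (\<forall>i\<in>vertices \<tau>. closure (U i) \<subseteq> W i \<and> closure (W i) \<subseteq> Fatou \<tau> i) \<and>
      (\<forall>es. admissible \<tau> es \<and> length es = N \<longrightarrow>
        (\<forall>h\<in>word_maps \<tau> es. closure (h ` W (fst (hd es))) \<subseteq> U (snd (last es)))) \<and>
      (\<forall>z. \<forall>i\<in>vertices \<tau>. \<exists>j\<in>vertices \<tau>. \<exists>h\<in>H_maps \<tau> i j. h z \<in> W j))"

definition forward_invariant :: "mrds \<Rightarrow> (nat \<Rightarrow> riemann_sphere set) \<Rightarrow> bool" where
  "forward_invariant \<tau> L \<longleftrightarrow>
    (\<forall>e\<in>edges \<tau>. \<forall>f\<in>edge_supp \<tau> e. rat_apply f ` L (fst e) \<subseteq> L (snd e))"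

definition invariant_compacta :: "mrds \<Rightarrow> (nat \<Rightarrow> riemann_sphere set) \<Rightarrow> bool" where
  "invariant_compacta \<tau> L \<longleftrightarrow>
    forward_invariant \<tau> L \<and> (\<forall>i\<in>vertices \<tau>. L i \<noteq> {} \<and> compact (L i))"

definition minimal_set :: "mrds \<Rightarrow> (nat \<Rightarrow> riemann_sphere set) \<Rightarrow> bool" where
  "minimal_set \<tau> L \<longleftrightarrow>
    invariant_compacta \<tau> L \<and>
    (\<forall>L'. invariant_compacta \<tau> L' \<and> (\<forall>i\<in>vertices \<tau>. L' i \<subseteq> L i) \<longrightarrow>
      (\<forall>i\<in>vertices \<tau>. L' i = L i))"

definition attracting_minimal_set :: "mrds \<Rightarrow> (nat \<Rightarrow> riemann_sphere set) \<Rightarrow> bool" where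
  "attracting_minimal_set \<tau> L \<longleftrightarrow>
    minimal_set \<tau> L \<and>
    (\<exists>N U W. N \<ge> 1 \<and>
      (\<forall>i\<in>vertices \<tau>. open (U i) \<and> open (W i)) \<and>
      (\<forall>i\<in>vertices \<tau>. L i \<subseteq> U i \<and> closure (U i) \<subseteq> W i \<and> closure (W i) \<subseteq> Fatou \<tau> i) \<and>
      (\<forall>es. admissible \<tau> es \<and> length es = N \<longrightarrow>
        (\<forall>h\<in>word_maps \<tau> es. closure (h ` W (fst (hd es))) \<subseteq> U (snd (last es)))))"

end

(* The idea: the bound alpha on the fibres of the bifurcation set leaves only a counting argument once
   each Bif_s is measurable, and Bif_s is closed because mean stability is an open condition.  The same
   N, U and W witness mean stability of a nearby system.  The contraction and reachability conditions
   survive by compactness.  For the Fatou condition, words of length divisible by N map a neighbourhood of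
   closure (W i) into some W j, whose complement contains a disc, so that Cauchy's estimate gives
   equicontinuity.  There is such a disc because no Fatou set is the whole sphere: an equicontinuous
   sequence of iterates of a surjection of a compact space forces injectivity, while rational maps of
   degree at least two are surjective and not injective. *)

theory Submission
  imports Defs "HOL-Complex_Analysis.Cauchy_Integral_Formula"
    "HOL-Computational_Algebra.Fundamental_Theorem_Algebra"
begin

text \<open>The obstacle is the Fatou condition: it concerns words of every length, whereas
  closeness of the supports controls words of bounded length. Contraction bridges the gap: it is
  asked of words of length \<open>N\<close>, persists on a small neighbourhood \<open>W'\<close> of
  the closure of \<open>W\<close>, and then iterates by itself. The neighbourhood is forced by the
  definition, since a point of the closure belongs to the Fatou set only through equicontinuity on
  an open set around it. The remaining letters of a word, fewer than \<open>N\<close>, come last,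
  and compactness of the union of the supports gives them a common modulus of continuity. The
  omitted disc depends on \<open>W\<close> alone, so it can be found from the Fatou set of the
  unperturbed system and serves all nearby ones. The counting is a double count: on a set
  \<open>A\<close> of finite measure, the measures of the sets Bif_s intersected with
  \<open>A\<close> add up, over any finite set of parameters \<open>s\<close>, to at most \<alpha>
  times the measure of \<open>A\<close>, so only finitely many of them exceed a given positive
  number.\<close>

section \<open>Topology of the sphere\<close>

lemma cos_dist_sphere: "cos (dist p q) = inner (stereo p) (stereo q)" for p q :: riemann_sphere
proof -
  have "\<bar>inner (stereo p) (stereo q)\<bar> \<le> 1"
    using Cauchy_Schwarz_ineq2[of "stereo p" "stereo q"] by (simp add: norm_stereo)
  then show ?thesis by (simp add: dist_riemann_sphere_def)
qed

text \<open>The chord of an arc of length \<open>d\<close> on the unit sphere measures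
  \<open>2 * sin (d / 2)\<close>, up to sign. So \<open>stereo\<close> is 1-Lipschitz, and
  continuity can be read off in the ambient Euclidean space.\<close>

lemma norm_stereo_diff_le: "norm (stereo p - stereo q) \<le> dist p q"
proof -
  define d where "d = dist p q"
  have "(norm (stereo p - stereo q))\<^sup>2 = 2 - 2 * cos d"
    unfolding power2_norm_eq_inner d_def cos_dist_sphere
    by (simp add: inner_diff inner_stereo_self inner_commute)
  also have "\<dots> = (2 * sin (d / 2))\<^sup>2"
    using cos_double_sin[of "d/2"] by (simp add: power2_eq_square)
  finally have "norm (stereo p - stereo q) = \<bar>2 * sin (d / 2)\<bar>"
    by (metis abs_norm_cancel real_sqrt_abs)
  also have "\<dots> \<le> d" using abs_sin_x_le_abs_x[of "d/2"] by (simp add: abs_mult d_def)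
  finally show ?thesis by (simp add: d_def)
qed

lemma continuous_on_stereo: "continuous_on A stereo"
  unfolding continuous_on_iff
  by (metis dist_norm norm_stereo_diff_le order_le_less_trans)

lemma inner_stereo_bounds: "-1 \<le> inner (stereo p) (stereo q)" "inner (stereo p) (stereo q) \<le> 1"
  using Cauchy_Schwarz_ineq2[of "stereo p" "stereo q"] by (auto simp: norm_stereo)

lemma continuous_on_Pt: "continuous_on A Pt"
proof -
  have "isCont Pt a" for a
  proof -
    have "1 + (cmod z)\<^sup>2 \<noteq> 0" "(cmod z)\<^sup>2 + 1 \<noteq> 0" for z
      using zero_le_power2[of "cmod z"] by linarith+
    then have "continuous_on UNIV (\<lambda>z. stereo (Pt z))"
      unfolding stereo.simps by (intro continuous_intros) auto
    then have "continuous_on UNIV (\<lambda>z. dist (Pt z) (Pt a))"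
      unfolding dist_riemann_sphere_def
      by (intro continuous_on_arccos continuous_on_inner continuous_on_const)
        (auto simp: inner_stereo_bounds simp del: stereo.simps)
    then have "((\<lambda>z. dist (Pt z) (Pt a)) \<longlongrightarrow> dist (Pt a) (Pt a)) (at a)"
      unfolding continuous_on_eq_continuous_at[OF open_UNIV] isCont_def by blast
    then show ?thesis unfolding isCont_def tendsto_dist_iff[of Pt] by simp
  qed
  then show ?thesis by (simp add: continuous_at_imp_continuous_on)
qed

text \<open>A left inverse of \<open>Pt\<close>; the value at \<open>Infty\<close> is a mere
  default, at which continuity fails.\<close>

fun finite_coord :: "riemann_sphere \<Rightarrow> complex" where
  "finite_coord (Pt z) = z"
| "finite_coord Infty = 0"

lemma continuous_on_finite_coord: "continuous_on (- {Infty}) finite_coord"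
proof -
  have ne: "snd (stereo p) \<noteq> 1" if "p \<noteq> Infty" for p
    using that by (cases p) (auto simp: divide_eq_eq split: if_splits)
  \<comment> \<open>Stereographic projection from the north pole \<open>(0, 1)\<close>, the image of
    \<open>Infty\<close>.\<close>
  have "finite_coord p = fst (stereo p) /\<^sub>R (1 - snd (stereo p))" if "p \<noteq> Infty" for p
  proof (cases p)
    case (Pt z)
    define k where "k = 2 / (1 + (cmod z)\<^sup>2)"
    have 1: "1 + (cmod z)\<^sup>2 > 0" using zero_le_power2[of "cmod z"] by linarith
    have "1 - ((cmod z)\<^sup>2 - 1) / ((cmod z)\<^sup>2 + 1) = k"
      using 1 by (simp add: k_def field_simps)
    moreover have "k \<noteq> 0" using 1 by (simp add: k_def)
    ultimately show ?thesis using Pt by (simp flip: k_def)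
  qed (use that in simp)
  moreover have "continuous_on (- {Infty}) (\<lambda>p. fst (stereo p) /\<^sub>R (1 - snd (stereo p)))"
    using ne by (intro continuous_intros continuous_on_stereo) auto
  ultimately show ?thesis by (subst continuous_on_cong[OF refl]) auto
qed

fun sphere_inv :: "riemann_sphere \<Rightarrow> riemann_sphere" where
  "sphere_inv (Pt z) = (if z = 0 then Infty else Pt (1 / z))"
| "sphere_inv Infty = Pt 0"

lemma sphere_inv_sphere_inv [simp]: "sphere_inv (sphere_inv p) = p"
  by (cases p) auto

text \<open>In the ambient space, inversion conjugates the complex coordinate and negates the
  height: a half turn about the real axis. Being an isometry, it reduces questions at
  \<open>Infty\<close> to questions at \<open>Pt 0\<close>.\<close>

lemma dist_sphere_inv [simp]: "dist (sphere_inv p) (sphere_inv q) = dist p q"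
proof -
  have st: "stereo (sphere_inv p) = (cnj (fst (stereo p)), - snd (stereo p))" for p
  proof (cases p)
    case (Pt z)
    show ?thesis
    proof (cases "z = 0")
      case False
      define r where "r = (cmod z)\<^sup>2"
      have r: "r > 0" using False by (simp add: r_def)
      have "1 / z = cnj z /\<^sub>R r"
        using False complex_div_cnj[of 1 z] by (simp add: r_def scaleR_conv_of_real divide_inverse mult.commute)
      moreover have "(cmod (1 / z))\<^sup>2 = 1 / r" by (simp add: r_def norm_divide power_divide)
      moreover have "2 / (1 + 1 / r) * inverse r = 2 / (1 + r)" "(1 / r - 1) / (1 / r + 1) = - ((r - 1) / (r + 1))"
        using r by (simp_all add: field_simps add_nonneg_eq_0_iff)
      ultimately show ?thesis
        using Pt False by (simp flip: r_def del: inverse_eq_divide)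
    qed (use Pt in simp)
  qed simp
  have "inner (cnj a) (cnj b) = inner a b" for a b by (simp add: inner_complex_def)
  then show ?thesis unfolding dist_riemann_sphere_def st by (simp add: inner_prod_def)
qed

lemma continuous_on_sphere_inv: "continuous_on A sphere_inv"
  unfolding continuous_on_iff by auto

lemma sphere_eq_Pt_Un_inv: "(UNIV :: riemann_sphere set) = Pt ` cball 0 1 \<union> sphere_inv ` Pt ` cball 0 1"
proof -
  have "p \<in> Pt ` cball 0 1 \<union> sphere_inv ` Pt ` cball 0 1" for p
  proof (cases p)
    case (Pt z)
    show ?thesis
    proof (cases "cmod z \<le> 1")
      case False
      then have "p = sphere_inv (Pt (1 / z))" "1 / z \<in> cball 0 1" using Pt by (auto simp: norm_divide divide_simps)
      then show ?thesis by blast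
    qed (use Pt in auto)
  next
    case Infty
    then have "p = sphere_inv (Pt 0)" by simp
    then show ?thesis by (metis UnI2 centre_in_cball image_eqI zero_le_one)
  qed
  then show ?thesis by blast
qed

lemma compact_sphere: "compact (UNIV :: riemann_sphere set)"
  unfolding sphere_eq_Pt_Un_inv
  by (intro compact_Un compact_continuous_image continuous_on_Pt continuous_on_sphere_inv compact_cball)

lemma Pt_nhds:
  assumes "r > 0"
  shows "\<exists>\<delta>>0. \<forall>p. dist p (Pt a) < \<delta> \<longrightarrow> p \<in> Pt ` ball a r"
proof -
  obtain d where d: "d > 0" "\<And>p. p \<in> -{Infty} \<Longrightarrow> dist p (Pt a) < d \<Longrightarrow> dist (finite_coord p) a < r"
    using continuous_on_finite_coord assms unfolding continuous_on_iff
    by (metis ComplI finite_coord.simps(1) riemann_sphere.distinct(1) singletonD)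
  show ?thesis
  \<comment> \<open>The second bound excludes \<open>Infty\<close>, where the estimate for
    \<open>finite_coord\<close> does not apply.\<close>
  proof (intro exI[of _ "min d (dist Infty (Pt a))"] conjI allI impI)
    fix p assume p: "dist p (Pt a) < min d (dist Infty (Pt a))"
    then have "p \<noteq> Infty" by auto
    then show "p \<in> Pt ` ball a r"
      using d(2)[of p] p by (cases p) (auto simp: dist_commute)
  qed (use d in auto)
qed

section \<open>Rational maps in homogeneous coordinates\<close>

text \<open>The point with homogeneous coordinates \<open>[x : y]\<close>. The pair
  \<open>(0, 0)\<close> also gives \<open>Infty\<close>, which is why lifts are required to have no
  common zero.\<close>

definition hproj :: "complex \<Rightarrow> complex \<Rightarrow> riemann_sphere" where
  "hproj x y = (if y = 0 then Infty else Pt (x / y))"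

text \<open>The degree is a parameter because numerator and denominator have to be homogenised to
  the same degree, the larger of the two.\<close>

definition hom_poly :: "nat \<Rightarrow> complex poly \<Rightarrow> complex \<Rightarrow> complex \<Rightarrow> complex" where
  "hom_poly d p x y = (\<Sum>k\<le>d. coeff p k * x ^ k * y ^ (d - k))"

lemma hom_poly_nonzero:
  assumes "degree p \<le> d" "y \<noteq> 0"
  shows "hom_poly d p x y = y ^ d * poly p (x / y)"
proof -
  have "poly p (x / y) = (\<Sum>k\<le>d. coeff p k * (x / y) ^ k)"
    unfolding poly_altdef using assms(1) by (intro sum.mono_neutral_left) (auto simp: coeff_eq_0)
  also have "y ^ d * \<dots> = hom_poly d p x y"
    unfolding hom_poly_def sum_distrib_left
  proof (rule sum.cong)
    fix k assume "k \<in> {..d}"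
    then have "y ^ d = y ^ k * y ^ (d - k)" by (simp flip: power_add)
    then show "y ^ d * (coeff p k * (x / y) ^ k) = coeff p k * x ^ k * y ^ (d - k)"
      using assms(2) by (simp add: power_divide)
  qed simp
  finally show ?thesis by simp
qed

lemma hom_poly_0: "hom_poly d p x 0 = coeff p d * x ^ d"
proof -
  have "hom_poly d p x 0 = (\<Sum>k\<in>{d}. coeff p k * x ^ k * 0 ^ (d - k))"
    unfolding hom_poly_def by (intro sum.mono_neutral_right) auto
  then show ?thesis by simp
qed

lemma rational_fun_hproj:
  assumes "x \<noteq> 0 \<or> y \<noteq> 0"
  shows "rational_fun p q (hproj x y) =
    hproj (hom_poly (max (degree p) (degree q)) p x y) (hom_poly (max (degree p) (degree q)) q x y)"
proof (cases "y = 0")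
  case True
  then show ?thesis using assms by (simp add: hproj_def hom_poly_0 Let_def)
next
  case False
  then show ?thesis by (simp add: hproj_def hom_poly_nonzero)
qed

text \<open>Off \<open>y = 0\<close> a common zero would be a common root of \<open>p\<close> and
  \<open>q\<close>. At \<open>y = 0\<close> the values are multiples of the coefficients of index
  \<open>d\<close>, one of which is a nonzero leading coefficient.\<close>

lemma hom_poly_no_common_zero:
  assumes "coprime p q" "max (degree p) (degree q) = d" "x \<noteq> 0 \<or> y \<noteq> 0"
  shows "hom_poly d p x y \<noteq> 0 \<or> hom_poly d q x y \<noteq> 0"
proof (cases "y = 0")
  case True
  have "coeff p d \<noteq> 0 \<or> coeff q d \<noteq> 0"
  proof (rule ccontr)
    assume "\<not> (coeff p d \<noteq> 0 \<or> coeff q d \<noteq> 0)"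
    then have "p = 0 \<or> q = 0" "degree p = 0 \<and> degree q = 0"
      using assms(2) by (auto simp: max_def split: if_splits)
    then have "poly p 0 = 0 \<and> poly q 0 = 0"
      using \<open>\<not> _\<close> assms(2) by (auto simp: poly_0_coeff_0)
    then show False using coprime_poly_0[OF assms(1)] by blast
  qed
  then show ?thesis using True assms(3) by (simp add: hom_poly_0)
next
  case False
  then show ?thesis
    using coprime_poly_0[OF assms(1)] assms(2) by (auto simp: hom_poly_nonzero)
qed

text \<open>A holomorphic map from the plane to the sphere, lifted to homogeneous coordinates; the lift makes
  closure under composition with rational maps immediate.\<close>

definition entire_lift :: "(complex \<Rightarrow> riemann_sphere) \<Rightarrow> bool" where
  "entire_lift h \<longleftrightarrow> (\<exists>P Q. P holomorphic_on UNIV \<and> Q holomorphic_on UNIV \<and>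
    (\<forall>z. (P z \<noteq> 0 \<or> Q z \<noteq> 0) \<and> h z = hproj (P z) (Q z)))"

lemma entire_liftI:
  assumes "P holomorphic_on UNIV" "Q holomorphic_on UNIV" "\<And>z. P z \<noteq> 0 \<or> Q z \<noteq> 0"
    "\<And>z. h z = hproj (P z) (Q z)"
  shows "entire_lift h"
  using assms unfolding entire_lift_def by blast

lemma entire_lift_Pt: "entire_lift Pt"
  by (rule entire_liftI[of "\<lambda>z. z" "\<lambda>_. 1"]) (auto simp: hproj_def)

lemma entire_lift_inv_Pt: "entire_lift (\<lambda>z. sphere_inv (Pt z))"
  by (rule entire_liftI[of "\<lambda>_. 1" "\<lambda>z. z"]) (auto simp: hproj_def)

lemma rat_apply_rational_fun:
  obtains p q where "coprime p q" "max (degree p) (degree q) \<ge> 2" "rat_apply f = rational_fun p q"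
  using rat_apply[of f] by blast

lemma entire_lift_rat_apply:
  assumes "entire_lift h"
  shows "entire_lift (\<lambda>z. rat_apply f (h z))"
proof -
  obtain P Q where PQ: "P holomorphic_on UNIV" "Q holomorphic_on UNIV"
    "\<And>z. P z \<noteq> 0 \<or> Q z \<noteq> 0" "\<And>z. h z = hproj (P z) (Q z)"
    using assms unfolding entire_lift_def by blast
  obtain p q where pq: "coprime p q" "rat_apply f = rational_fun p q"
    by (rule rat_apply_rational_fun)
  let ?d = "max (degree p) (degree q)"
  show ?thesis
  proof (rule entire_liftI)
    show "(\<lambda>z. hom_poly ?d p (P z) (Q z)) holomorphic_on UNIV"
      "(\<lambda>z. hom_poly ?d q (P z) (Q z)) holomorphic_on UNIV"
      unfolding hom_poly_def by (intro holomorphic_intros PQ)+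
    show "rat_apply f (h z) = hproj (hom_poly ?d p (P z) (Q z)) (hom_poly ?d q (P z) (Q z))" for z
      unfolding pq(2) PQ(4) by (rule rational_fun_hproj[OF PQ(3)])
  qed (use hom_poly_no_common_zero[OF pq(1) refl PQ(3)] in auto)
qed

text \<open>Where \<open>Q\<close> is nonzero the map is \<open>Pt (P / Q)\<close>, where
  \<open>P\<close> is nonzero it is the inversion of \<open>Pt (Q / P)\<close>, and these two open
  sets cover the plane.\<close>

lemma continuous_on_entire_lift:
  assumes "entire_lift h"
  shows "continuous_on A h"
proof -
  obtain P Q where PQ: "P holomorphic_on UNIV" "Q holomorphic_on UNIV"
    "\<And>z. P z \<noteq> 0 \<or> Q z \<noteq> 0" "\<And>z. h z = hproj (P z) (Q z)"
    using assms unfolding entire_lift_def by blast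
  note c = holomorphic_on_imp_continuous_on[OF PQ(1)] holomorphic_on_imp_continuous_on[OF PQ(2)]
  have c': "continuous_on S P" "continuous_on S Q" for S
    using c continuous_on_subset by blast+
  have o: "open {z. P z \<noteq> 0}" "open {z. Q z \<noteq> 0}"
    by (intro open_Collect_neq c continuous_on_const)+
  have "continuous_on {z. Q z \<noteq> 0} (\<lambda>z. Pt (P z / Q z))"
    by (intro continuous_on_compose2[OF continuous_on_Pt[of UNIV]] continuous_intros c') auto
  then have 1: "continuous_on {z. Q z \<noteq> 0} h"
    by (subst continuous_on_cong[OF refl, of _ _ "\<lambda>z. Pt (P z / Q z)"]) (auto simp: PQ(4) hproj_def)
  have "continuous_on {z. P z \<noteq> 0} (\<lambda>z. sphere_inv (Pt (Q z / P z)))"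
    by (intro continuous_on_compose2[OF continuous_on_sphere_inv[of UNIV]]
        continuous_on_compose2[OF continuous_on_Pt[of UNIV]] continuous_intros c') auto
  then have 2: "continuous_on {z. P z \<noteq> 0} h"
    by (subst continuous_on_cong[OF refl, of _ _ "\<lambda>z. sphere_inv (Pt (Q z / P z))"])
      (auto simp: PQ(4) hproj_def)
  have "continuous_on ({z. Q z \<noteq> 0} \<union> {z. P z \<noteq> 0}) h"
    by (rule continuous_on_open_Un[OF o(2,1) 1 2])
  moreover have "{z. Q z \<noteq> 0} \<union> {z. P z \<noteq> 0} = UNIV" using PQ(3) by auto
  ultimately show ?thesis using continuous_on_subset[of UNIV h A] by simp
qed

text \<open>Moves local statements from the sphere to discs in the plane. By the last property
  \<kappa> is open at \<open>a\<close>, so an estimate on a disc about \<open>a\<close> holds on a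
  spherical neighbourhood of \<open>z0\<close>.\<close>

lemma sphere_chart:
  obtains \<kappa> a where "entire_lift \<kappa>" "\<kappa> a = z0"
    "\<forall>r>0. \<exists>\<delta>>0. \<forall>p. dist p z0 < \<delta> \<longrightarrow> p \<in> \<kappa> ` ball a r"
proof (cases z0)
  case (Pt a)
  show ?thesis
    using that[OF entire_lift_Pt] Pt Pt_nhds by metis
next
  case Infty
  have "\<exists>\<delta>>0. \<forall>p. dist p z0 < \<delta> \<longrightarrow> p \<in> (\<lambda>z. sphere_inv (Pt z)) ` ball 0 r" if "r > 0" for r
  proof -
    obtain \<delta> where d: "\<delta> > 0" "\<forall>p. dist p (Pt 0) < \<delta> \<longrightarrow> p \<in> Pt ` ball 0 r"
      using Pt_nhds[OF \<open>r > 0\<close>] by meson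
    have "p \<in> (\<lambda>z. sphere_inv (Pt z)) ` ball 0 r" if p: "dist p z0 < \<delta>" for p
    proof -
      have "dist (sphere_inv p) (Pt 0) = dist p z0"
        using dist_sphere_inv[of p Infty] unfolding Infty sphere_inv.simps .
      then have "sphere_inv p \<in> Pt ` ball 0 r" using d(2) p by (metis (no_types))
      then obtain z where z: "z \<in> ball 0 r" "sphere_inv p = Pt z" by (rule imageE)
      then have "p = sphere_inv (Pt z)" by (metis sphere_inv_sphere_inv)
      then show ?thesis using z(1) by blast
    qed
    then show ?thesis using d(1) by blast
  qed
  then have "\<forall>r>0. \<exists>\<delta>>0. \<forall>p. dist p z0 < \<delta> \<longrightarrow> p \<in> (\<lambda>z. sphere_inv (Pt z)) ` ball 0 r"
    by blast
  then show ?thesis by (rule that[OF entire_lift_inv_Pt, rotated]) (simp add: Infty)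
qed

section \<open>Continuity, surjectivity and non-injectivity of rational maps\<close>

lemma continuous_on_rat_apply: "continuous_on A (rat_apply f)"
proof -
  have "\<exists>\<delta>>0. \<forall>p. dist p p0 < \<delta> \<longrightarrow> dist (rat_apply f p) (rat_apply f p0) < e" if e: "e > 0" for p0 e
  proof -
    obtain \<kappa> a where \<kappa>: "entire_lift \<kappa>" "\<kappa> a = p0"
      "\<forall>r>0. \<exists>\<delta>>0. \<forall>p. dist p p0 < \<delta> \<longrightarrow> p \<in> \<kappa> ` ball a r"
      using sphere_chart[of p0] .
    have "isCont (\<lambda>z. rat_apply f (\<kappa> z)) a"
      using continuous_on_entire_lift[OF entire_lift_rat_apply[OF \<kappa>(1)], of UNIV f]
      by (simp add: continuous_on_eq_continuous_at)
    then obtain r where r: "r > 0" "\<And>z. dist z a < r \<Longrightarrow> dist (rat_apply f (\<kappa> z)) (rat_apply f p0) < e"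
      using e \<kappa>(2) unfolding continuous_at_eps_delta by metis
    obtain \<delta> where "\<delta> > 0" "\<forall>p. dist p p0 < \<delta> \<longrightarrow> p \<in> \<kappa> ` ball a r"
      using \<kappa>(3) r(1) by meson
    moreover have "dist (rat_apply f p) (rat_apply f p0) < e" if "p \<in> \<kappa> ` ball a r" for p
      using that r(2) by (auto simp: dist_commute)
    ultimately show ?thesis by blast
  qed
  then show ?thesis unfolding continuous_on_iff by blast
qed

lemma surj_rat_apply: "surj (rat_apply f)"
proof -
  obtain p q where pq: "coprime p q" "max (degree p) (degree q) \<ge> 2" "rat_apply f = rational_fun p q"
    by (rule rat_apply_rational_fun)
  let ?d = "max (degree p) (degree q)"
  have "\<exists>x. rational_fun p q x = w" for w
  proof (cases w)
    case w: (Pt v)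
    let ?r = "p - smult v q"
    show ?thesis
    \<comment> \<open>Finite preimages of \<open>v\<close> are roots of \<open>p - v q\<close>. If
      this polynomial is constant, the coefficients of index \<open>?d\<close> of \<open>p\<close>
      and \<open>q\<close> have ratio \<open>v\<close>, so \<open>v\<close> is the value at
      \<open>Infty\<close>.\<close>
    proof (cases "degree ?r = 0")
      case True
      then have "coeff p ?d = v * coeff q ?d"
        using pq(2) coeff_eq_0[of ?r ?d] by simp
      moreover have "coeff q ?d \<noteq> 0"
        using pq(1,2) calculation by (auto simp: max_def split: if_splits)
      ultimately have "rational_fun p q Infty = Pt v" by (simp add: Let_def)
      then show ?thesis using w by blast
    next
      case False
      then obtain z where "poly ?r z = 0"
        using alg_closed_imp_poly_has_root by blast
      moreover then have "poly q z \<noteq> 0" using coprime_poly_0[OF pq(1), of z] by auto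
      ultimately have "rational_fun p q (Pt z) = Pt v" by (simp add: field_simps)
      then show ?thesis using w by blast
    qed
  next
    case Infty
    show ?thesis
    proof (cases "degree q = 0")
      case True
      then have "coeff q ?d = 0" using pq(2) by (intro coeff_eq_0) simp
      then have "rational_fun p q Infty = Infty" by (simp add: Let_def)
      then show ?thesis using Infty by blast
    next
      case False
      then obtain z where "poly q z = 0"
        using alg_closed_imp_poly_has_root by blast
      then have "rational_fun p q (Pt z) = Infty" by simp
      then show ?thesis using Infty by blast
    qed
  qed
  then show ?thesis unfolding pq(3) surj_def by metis
qed

text \<open>If \<open>p / q\<close> were injective, almost every \<open>p - v q\<close> would have a single, hence multiple, root, at
  which the Wronskian \<open>p' q - p q'\<close> vanishes; so the Wronskian would be zero.\<close>

lemma not_inj_rat_apply: "\<not> inj (rat_apply f)"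
proof
  assume inj: "inj (rat_apply f)"
  obtain p q where pq: "coprime p q" "max (degree p) (degree q) \<ge> 2" "rat_apply f = rational_fun p q"
    by (rule rat_apply_rational_fun)
  define d where "d = max (degree p) (degree q)"
  \<comment> \<open>\<open>B\<close> collects the values \<open>v\<close> for which
    \<open>p - v q\<close> drops below degree \<open>d\<close>: the value at \<open>Infty\<close> if
    it is finite, and nothing otherwise.\<close>
  define B where "B = {v. coeff p d = v * coeff q d}"
  define W where "W = pderiv p * q - p * pderiv q"
  have nz: "coeff p d \<noteq> 0 \<or> coeff q d \<noteq> 0"
    using pq(2) by (auto simp: d_def max_def split: if_splits)
  have "B \<subseteq> {coeff p d / coeff q d}"
    using nz by (auto simp: B_def)
  then have "finite B" by (rule finite_subset) simp
  then have inf: "infinite (- B)" by (metis finite_compl infinite_UNIV_char_0)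
  have "\<exists>a. poly W a = 0 \<and> poly q a \<noteq> 0 \<and> v = poly p a / poly q a" if "v \<in> - B" for v
  proof -
    define R where "R = p - smult v q"
    have root: "poly q a \<noteq> 0 \<and> v = poly p a / poly q a" if "poly R a = 0" for a
      using that coprime_poly_0[OF pq(1), of a] by (auto simp: R_def field_simps)
    have "coeff R d \<noteq> 0" using \<open>v \<in> - B\<close> by (auto simp: R_def B_def)
    then have "degree R \<ge> d" by (rule le_degree)
    then have dR: "degree R \<ge> 2" using pq(2) unfolding d_def by linarith
    then obtain a where a: "poly R a = 0"
      using alg_closed_imp_poly_has_root[of R] by auto
    then obtain S where S: "R = [:-a, 1:] * S" by (metis dvdE poly_eq_0_iff_dvd)
    then have "S \<noteq> 0" using dR by auto
    then have "degree R = 1 + degree S" unfolding S by (subst degree_mult_eq) auto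
    then obtain b where b: "poly S b = 0"
      using alg_closed_imp_poly_has_root[of S] dR by auto
    then have "poly R b = 0" by (simp add: S)
    then have "rat_apply f (Pt a) = rat_apply f (Pt b)" using root[OF a] root[of b] pq(3) by simp
    then have "a = b" using inj by (auto dest: injD)
    then have "poly (pderiv R) a = 0" using b unfolding S pderiv_mult by (simp add: pderiv_pCons)
    then have 1: "poly (pderiv p) a = v * poly (pderiv q) a"
      by (simp add: R_def pderiv_diff pderiv_smult)
    moreover have 2: "poly p a = v * poly q a" using a by (simp add: R_def)
    ultimately have "poly W a = 0" by (simp add: W_def)
    then show ?thesis using root[OF a] by blast
  qed
  \<comment> \<open>The value \<open>v\<close> can be recovered from \<open>a v\<close>, so
    infinitely many \<open>v\<close> produce infinitely many zeros of \<open>W\<close>.\<close>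
  then obtain a where a: "\<And>v. v \<in> - B \<Longrightarrow> poly W (a v) = 0 \<and> v = poly p (a v) / poly q (a v)"
    by metis
  then have "inj_on a (- B)" by (metis inj_onI)
  then have "infinite (a ` (- B))" using inf finite_imageD by blast
  moreover have "a ` (- B) \<subseteq> {x. poly W x = 0}" using a by auto
  ultimately have "W = 0" using poly_roots_finite finite_subset by blast
  then have eq: "pderiv p * q = p * pderiv q" by (simp add: W_def)
  \<comment> \<open>A zero Wronskian forces both polynomials to be constant: at a root
    \<open>a\<close> of \<open>r\<close>, where \<open>s\<close> does not vanish, the identity makes
    the order of \<open>pderiv r\<close> at least that of \<open>r\<close>, although differentiation
    lowers the order of a root by one.\<close>
  have const: "degree r = 0" if "pderiv r * s = r * pderiv s" "coprime r s" for r s :: "complex poly"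
  proof (rule ccontr)
    assume "degree r \<noteq> 0"
    then obtain a where a: "poly r a = 0" using alg_closed_imp_poly_has_root[of r] by auto
    have r': "r \<noteq> 0" "pderiv r \<noteq> 0" using \<open>degree r \<noteq> 0\<close> by (auto simp: pderiv_eq_0_iff)
    have s: "poly s a \<noteq> 0" using coprime_poly_0[OF that(2), of a] a by simp
    then have "pderiv r * s \<noteq> 0" using r' by auto
    then have "order a (pderiv r) + order a s = order a r + order a (pderiv s)"
      using that(1) order_mult by metis
    moreover have "order a s = 0" using s by (simp add: order_0I)
    moreover have "order a r \<noteq> 0" using a r' by (simp add: order_root)
    ultimately show False using order_pderiv[OF r'(1) a] by simp
  qed
  have "degree p = 0" by (rule const[OF eq pq(1)])
  moreover have "degree q = 0"
    using const[of q p] eq pq(1) by (metis coprime_commute mult.commute)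
  ultimately show False using pq(2) by simp
qed

section \<open>Equicontinuity\<close>

text \<open>Cauchy's estimate applied to \<open>1 / (h - b)\<close>, which is bounded by \<open>1 / \<rho>\<close>.\<close>

lemma equicontinuous_omitting_disc:
  assumes r: "r > 0" and \<rho>: "\<rho> > 0" and e: "e > 0"
  shows "\<exists>\<delta>>0. \<forall>h. entire_lift h \<and> h ` ball a r \<inter> Pt ` ball b \<rho> = {} \<longrightarrow>
    (\<forall>z\<in>ball a \<delta>. dist (h z) (h a) < e)"
proof -
  \<comment> \<open>This is \<open>b + 1 / u\<close>, the inverse of \<open>1 / (w - b)\<close>, in
    homogeneous form so that \<open>0\<close> goes to \<open>Infty\<close>. Its modulus of
    continuity is fixed before \<open>h\<close> is chosen, hence common to all
    \<open>h\<close>.\<close>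
  define \<psi> where "\<psi> u = hproj (1 + b * u) u" for u
  have "entire_lift \<psi>"
  proof (rule entire_liftI[of "\<lambda>u. 1 + b * u" "\<lambda>u. u"])
    show "(\<lambda>u. 1 + b * u) holomorphic_on UNIV" "(\<lambda>u. u) holomorphic_on UNIV"
      by (intro holomorphic_intros)+
  qed (auto simp: \<psi>_def)
  then have "uniformly_continuous_on (cball 0 (1 / \<rho>)) \<psi>"
    by (intro compact_uniformly_continuous continuous_on_entire_lift compact_cball)
  then obtain \<eta> where \<eta>: "\<eta> > 0" "\<forall>v\<in>cball 0 (1 / \<rho>). \<forall>u\<in>cball 0 (1 / \<rho>).
      dist u v < \<eta> \<longrightarrow> dist (\<psi> u) (\<psi> v) < e"
    using e unfolding uniformly_continuous_on_def by meson
  \<comment> \<open>Cauchy's bound for the derivative on \<open>ball a (r / 2)\<close>, each point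
    of which is the centre of a closed disc of radius \<open>r / 4\<close> inside
    \<open>ball a r\<close>.\<close>
  define L where "L = (1 / \<rho>) / (r / 4)"
  have L: "L > 0" using r \<rho> by (simp add: L_def)
  define \<delta> where "\<delta> = min (r / 2) (\<eta> / L)"
  have "dist (h z) (h a) < e"
    if h: "entire_lift h" "h ` ball a r \<inter> Pt ` ball b \<rho> = {}" and z: "z \<in> ball a \<delta>" for h z
  proof -
    obtain P Q where PQ: "P holomorphic_on UNIV" "Q holomorphic_on UNIV"
      "\<And>z. P z \<noteq> 0 \<or> Q z \<noteq> 0" "\<And>z. h z = hproj (P z) (Q z)"
      using h(1) unfolding entire_lift_def by blast
    have far: "cmod (P w / Q w - b) \<ge> \<rho>" if "w \<in> ball a r" "Q w \<noteq> 0" for w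
    proof (rule ccontr)
      assume "\<not> ?thesis"
      then have "P w / Q w \<in> ball b \<rho>" by (simp add: dist_norm norm_minus_commute)
      then have "h w \<in> Pt ` ball b \<rho>" using that(2) by (simp add: PQ(4) hproj_def)
      then show False using h(2) that(1) by blast
    qed
    have nz: "P w - b * Q w \<noteq> 0" if "w \<in> ball a r" for w
    proof
      assume eq: "P w - b * Q w = 0"
      then have "Q w \<noteq> 0" using PQ(3)[of w] by auto
      then show False using far[OF that] eq \<rho> by (simp add: field_simps)
    qed
    \<comment> \<open>The function \<open>1 / (h - b)\<close> with denominators cleared: poles of
      \<open>h\<close> become zeros, and the new denominator has no zero because \<open>h\<close>
      omits \<open>b\<close>.\<close>
    define \<phi> where "\<phi> w = Q w / (P w - b * Q w)" for w
    have hol: "\<phi> holomorphic_on ball a r"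
      unfolding \<phi>_def using nz
      by (intro holomorphic_intros holomorphic_on_subset[OF PQ(1)] holomorphic_on_subset[OF PQ(2)]) auto
    have bd: "cmod (\<phi> w) \<le> 1 / \<rho>" if w: "w \<in> ball a r" for w
    proof (cases "Q w = 0")
      case False
      then have "\<phi> w = 1 / (P w / Q w - b)" using nz[OF w] by (simp add: \<phi>_def field_simps)
      then show ?thesis using far[OF w False] \<rho> by (simp add: norm_divide frac_le)
    qed (use \<rho> in \<open>simp add: \<phi>_def\<close>)
    have h_eq: "h w = \<psi> (\<phi> w)" if w: "w \<in> ball a r" for w
    proof -
      have "1 + b * \<phi> w = P w / (P w - b * Q w)" using nz[OF w] by (simp add: \<phi>_def field_simps)
      then show ?thesis using nz[OF w] by (simp add: PQ(4) \<psi>_def hproj_def \<phi>_def)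
    qed
    have sub: "cball w (r / 4) \<subseteq> ball a r" if w: "w \<in> ball a (r / 2)" for w
    proof
      fix x assume "x \<in> cball w (r / 4)"
      then show "x \<in> ball a r" using w dist_triangle[of a x w] r by auto
    qed
    have der: "cmod (deriv \<phi> w) \<le> L" if w: "w \<in> ball a (r / 2)" for w
    proof -
      have "cmod ((deriv ^^ 1) \<phi> w) \<le> fact 1 * (1 / \<rho>) / (r / 4) ^ 1"
      proof (rule Cauchy_inequality)
        show "\<phi> holomorphic_on ball w (r / 4)"
          by (rule holomorphic_on_subset[OF hol]) (use sub[OF w] in auto)
        show "continuous_on (cball w (r / 4)) \<phi>"
          by (rule holomorphic_on_imp_continuous_on, rule holomorphic_on_subset[OF hol sub[OF w]])
        show "cmod (\<phi> x) \<le> 1 / \<rho>" if "cmod (w - x) = r / 4" for x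
          using sub[OF w] that by (intro bd) (auto simp: dist_norm)
      qed (use r in simp)
      then show ?thesis by (simp add: L_def)
    qed
    have z2: "z \<in> ball a (r / 2)" "a \<in> ball a (r / 2)" using z r by (auto simp: \<delta>_def)
    then have zr: "z \<in> ball a r" "a \<in> ball a r" using r by auto
    have "cmod (\<phi> z - \<phi> a) \<le> L * cmod (z - a)"
    proof (rule field_differentiable_bound[OF convex_ball _ _ z2])
      show "(\<phi> has_field_derivative deriv \<phi> w) (at w within ball a (r / 2))"
        if "w \<in> ball a (r / 2)" for w
        using that r by (intro DERIV_subset[OF holomorphic_derivI[OF hol, of w UNIV]]) auto
    qed (rule der)
    also have "\<dots> < \<eta>" using z L by (simp add: \<delta>_def dist_norm norm_minus_commute field_simps)
    finally have "dist (\<psi> (\<phi> z)) (\<psi> (\<phi> a)) < e"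
      using bd[OF zr(1)] bd[OF zr(2)] \<eta>(2) by (simp add: dist_norm)
    then show ?thesis using h_eq zr by simp
  qed
  moreover have "\<delta> > 0" using r \<eta>(1) L by (simp add: \<delta>_def)
  ultimately show ?thesis by blast
qed

text \<open>Pull the two points of a fibre back along \<open>g\<close>; two late members of each of the resulting
  sequences are close, and equicontinuity carries this closeness forward to the fibre.\<close>

lemma equicontinuous_surj_imp_inj:
  fixes g :: "'a::metric_space \<Rightarrow> 'a"
  assumes comp: "compact (UNIV :: 'a set)" and "surj g"
    and eq: "\<And>x e. e > 0 \<Longrightarrow> \<exists>\<delta>>0. \<forall>n>0. \<forall>y. dist y x < \<delta> \<longrightarrow> dist ((g ^^ n) y) ((g ^^ n) x) < e"
  shows "inj g"
proof (rule injI, rule ccontr)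
  fix x y assume gxy: "g x = g y" and "x \<noteq> y"
  \<comment> \<open>A backward orbit of \<open>z\<close>, chosen along one fixed right inverse of
    \<open>g\<close>.\<close>
  define c where "c k z = (inv g ^^ k) z" for k z
  have c: "(g ^^ k) (c k z) = z" for k z
  proof (induction k)
    case (Suc k)
    have "(g ^^ Suc k) (c (Suc k) z) = (g ^^ k) (g (inv g (c k z)))"
      by (simp add: c_def funpow_swap1)
    then show ?case using Suc by (simp add: surj_f_inv_f[OF assms(2)])
  qed (simp add: c_def)
  have c': "(g ^^ l) (c k z) = (g ^^ (l - k)) z" if "k \<le> l" for k l z
  proof -
    have "(g ^^ l) (c k z) = (g ^^ (l - k)) ((g ^^ k) (c k z))"
      using that fun_cong[OF funpow_add[of "l - k" k g]] by simp
    then show ?thesis by (simp add: c)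
  qed
  \<comment> \<open>The final triangle inequality has four terms, each smaller than
    \<open>e\<close>.\<close>
  define e where "e = dist x y / 4"
  have e: "e > 0" using \<open>x \<noteq> y\<close> by (simp add: e_def)
  have sc: "seq_compact (UNIV :: 'a set)" using comp by (simp add: compact_eq_seq_compact_metric)
  obtain u r where r: "strict_mono r" "((\<lambda>k. c k x) \<circ> r) \<longlonglongrightarrow> u"
    by (rule seq_compactE[OF sc, of "\<lambda>k. c k x"]) auto
  \<comment> \<open>Extracted from the first subsequence, so that both backward orbits converge
    along the same indices.\<close>
  obtain v r' where r': "strict_mono r'" "((\<lambda>k. c (r k) y) \<circ> r') \<longlonglongrightarrow> v"
    by (rule seq_compactE[OF sc, of "\<lambda>k. c (r k) y"]) auto
  have u: "(\<lambda>n. c (r (r' n)) x) \<longlonglongrightarrow> u"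
    using LIMSEQ_subseq_LIMSEQ[OF r(2) r'(1)] by (simp add: o_def)
  have v: "(\<lambda>n. c (r (r' n)) y) \<longlonglongrightarrow> v" using r'(2) by (simp add: o_def)
  obtain d1 where d1: "d1 > 0" "\<And>n w. n > 0 \<Longrightarrow> dist w u < d1 \<Longrightarrow> dist ((g ^^ n) w) ((g ^^ n) u) < e"
    using eq[OF e, of u] by blast
  obtain d2 where d2: "d2 > 0" "\<And>n w. n > 0 \<Longrightarrow> dist w v < d2 \<Longrightarrow> dist ((g ^^ n) w) ((g ^^ n) v) < e"
    using eq[OF e, of v] by blast
  have "\<forall>\<^sub>F n in sequentially. dist (c (r (r' n)) x) u < d1 \<and> dist (c (r (r' n)) y) v < d2"
    using u v d1(1) d2(1) by (intro eventually_conj tendstoD)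
  then obtain n where n: "\<And>m. m \<ge> n \<Longrightarrow> dist (c (r (r' m)) x) u < d1 \<and> dist (c (r (r' m)) y) v < d2"
    unfolding eventually_sequentially by blast
  define k l where "k = r (r' n)" and "l = r (r' (Suc n))"
  have kl: "k < l" using r(1) r'(1) by (simp add: k_def l_def strict_mono_def)
  have near: "dist (c k x) u < d1" "dist (c k y) v < d2" "dist (c l x) u < d1" "dist (c l y) v < d2"
    using n[of n] n[of "Suc n"] by (simp_all add: k_def l_def)
  obtain m where m: "l - k = Suc m" using kl by (cases "l - k") auto
  have same: "(g ^^ (l - k)) x = (g ^^ (l - k)) y"
    unfolding m funpow_Suc_right by (simp add: gxy)
  \<comment> \<open>Since \<open>k < l\<close>, the forward orbits of \<open>x\<close> and
    \<open>y\<close> have merged in \<open>w\<close>. Thus \<open>g ^^ l\<close> takes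
    \<open>c k x\<close> and \<open>c l x\<close>, both near \<open>u\<close>, to \<open>w\<close>
    and \<open>x\<close>, and takes \<open>c k y\<close> and \<open>c l y\<close>, both near
    \<open>v\<close>, to \<open>w\<close> and \<open>y\<close>.\<close>
  define w where "w = (g ^^ (l - k)) x"
  have "dist x ((g ^^ l) u) < e" "dist w ((g ^^ l) u) < e" "dist y ((g ^^ l) v) < e" "dist w ((g ^^ l) v) < e"
    using d1(2)[OF _ near(1), of l] d1(2)[OF _ near(3), of l] d2(2)[OF _ near(2), of l]
      d2(2)[OF _ near(4), of l] kl same by (simp_all add: c c' w_def)
  moreover have "dist x y \<le> dist x ((g ^^ l) u) + dist w ((g ^^ l) u) + (dist y ((g ^^ l) v) + dist w ((g ^^ l) v))"
    using dist_triangle[of x y w] dist_triangle2[of x w "(g ^^ l) u"] dist_triangle2[of y w "(g ^^ l) v"]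
    by (simp add: dist_commute)
  ultimately show False by (simp add: e_def)
qed

section \<open>Words of rational maps\<close>

lemma compose_maps_Nil [simp]: "compose_maps [] = id"
  by (simp add: compose_maps_def)

lemma compose_maps_Cons [simp]: "compose_maps (f # fs) z = compose_maps fs (rat_apply f z)"
proof -
  have "fold (\<lambda>f h. rat_apply f \<circ> h) fs g = fold (\<lambda>f h. rat_apply f \<circ> h) fs id \<circ> g"
    for g :: "riemann_sphere \<Rightarrow> riemann_sphere"
  proof (induction fs arbitrary: g)
    case (Cons a fs)
    show ?case using Cons[of "rat_apply a \<circ> g"] Cons[of "rat_apply a"] by (simp add: comp_assoc)
  qed simp
  from this[of "rat_apply f"] show ?thesis by (simp add: compose_maps_def)
qed

lemma compose_maps_append [simp]: "compose_maps (fs @ gs) z = compose_maps gs (compose_maps fs z)"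
  by (induction fs arbitrary: z) auto

lemma entire_lift_compose_maps: "entire_lift h \<Longrightarrow> entire_lift (\<lambda>z. compose_maps fs (h z))"
  by (induction fs arbitrary: h) (auto intro: entire_lift_rat_apply)

lemma continuous_on_compose_maps: "continuous_on A (compose_maps fs)"
proof (induction fs arbitrary: A)
  case (Cons f fs)
  have "compose_maps (f # fs) = compose_maps fs \<circ> rat_apply f" by auto
  then show ?case
    using continuous_on_compose[OF continuous_on_rat_apply Cons, of A f] by metis
qed (simp add: continuous_on_id')

lemma surj_compose_maps: "surj (compose_maps fs)"
proof (induction fs)
  case (Cons f fs)
  have "compose_maps (f # fs) = compose_maps fs \<circ> rat_apply f" by auto
  then show ?case using comp_surj[OF surj_rat_apply Cons, of f] by metis
qed simp

lemma not_inj_compose_maps: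
  assumes "fs \<noteq> []"
  shows "\<not> inj (compose_maps fs)"
proof -
  obtain f fs' where "fs = f # fs'" using assms by (cases fs) auto
  then have "compose_maps fs = compose_maps fs' \<circ> rat_apply f" by auto
  then show ?thesis using not_inj_rat_apply inj_on_imageI2 by metis
qed

lemma admissible_append:
  assumes "es \<noteq> []" "es' \<noteq> []"
  shows "admissible \<tau> (es @ es') \<longleftrightarrow>
    admissible \<tau> es \<and> admissible \<tau> es' \<and> snd (last es) = fst (hd es')"
proof -
  have adm: "admissible \<tau> es \<longleftrightarrow> es \<noteq> [] \<and> set es \<subseteq> edges \<tau> \<and> successively (\<lambda>e e'. snd e = fst e') es" for es
    by (auto simp: admissible_def successively_conv_nth)
  show ?thesis using assms by (auto simp: adm successively_append_iff)
qed

lemma admissible_vertices: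
  assumes "admissible \<tau> es"
  shows "fst (hd es) \<in> vertices \<tau>" "snd (last es) \<in> vertices \<tau>"
proof -
  have "hd es \<in> edges \<tau>" "last es \<in> edges \<tau>"
    using assms by (auto simp: admissible_def)
  then show "fst (hd es) \<in> vertices \<tau>" "snd (last es) \<in> vertices \<tau>"
    by (auto simp: edges_def split_def)
qed

lemma H_maps_comp:
  assumes "g \<in> H_maps \<tau> i j" "h \<in> H_maps \<tau> j k"
  shows "h \<circ> g \<in> H_maps \<tau> i k"
proof -
  obtain es fs where 1: "admissible \<tau> es" "fst (hd es) = i" "snd (last es) = j"
      "list_all2 (\<lambda>f e. f \<in> edge_supp \<tau> e) fs es" "g = compose_maps fs"
    using assms(1) unfolding H_maps_def word_maps_def by blast
  obtain es' fs' where 2: "admissible \<tau> es'" "fst (hd es') = j" "snd (last es') = k"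
      "list_all2 (\<lambda>f e. f \<in> edge_supp \<tau> e) fs' es'" "h = compose_maps fs'"
    using assms(2) unfolding H_maps_def word_maps_def by blast
  have ne: "es \<noteq> []" "es' \<noteq> []" using 1 2 by (auto simp: admissible_def)
  have "h \<circ> g = compose_maps (fs @ fs')" using 1 2 by auto
  moreover have "list_all2 (\<lambda>f e. f \<in> edge_supp \<tau> e) (fs @ fs') (es @ es')"
    using 1 2 by (intro list_all2_appendI)
  moreover have "admissible \<tau> (es @ es')" using 1 2 ne by (simp add: admissible_append)
  moreover have "fst (hd (es @ es')) = i" "snd (last (es @ es')) = k" using 1 2 ne by auto
  ultimately show ?thesis unfolding H_maps_def word_maps_def by blast
qed

text \<open>Strong connectivity is stated with a reflexive closure, so it gives no cycle by itself;
  total mass 1 supplies a first edge out of \<open>i\<close>, from which a path leads back.\<close>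

lemma exists_loop:
  assumes \<tau>: "\<tau> \<in> MRDS X" and i: "i \<in> vertices \<tau>"
  obtains es where "admissible \<tau> es" "fst (hd es) = i" "snd (last es) = i"
proof -
  have "(\<Sum>j\<in>vertices \<tau>. emeasure (transition \<tau> i j) UNIV) = 1"
    using \<tau> i by (simp add: MRDS_def is_mrds_def vertices_def)
  moreover have "(\<Sum>j\<in>vertices \<tau>. emeasure (transition \<tau> i j) UNIV) = 0"
    if "\<forall>j\<in>vertices \<tau>. emeasure (transition \<tau> i j) UNIV = 0"
    using that by (intro sum.neutral)
  ultimately obtain j where j: "j \<in> vertices \<tau>" "emeasure (transition \<tau> i j) UNIV \<noteq> 0"
    by fastforce
  then have ij: "(i, j) \<in> edges \<tau>" using i by (auto simp: edges_def zero_less_iff_neq_zero)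
  have path: "\<exists>es. admissible \<tau> es \<and> fst (hd es) = i \<and> snd (last es) = k"
    if "(i, k) \<in> (edges \<tau>)\<^sup>+" for k
    using that
  proof (induction rule: trancl_induct)
    case (base y)
    then show ?case by (intro exI[of _ "[(i, y)]"]) (simp add: admissible_def)
  next
    case (step y z)
    then obtain es where es: "admissible \<tau> es" "fst (hd es) = i" "snd (last es) = y" by blast
    have "admissible \<tau> [(y, z)]" using step by (simp add: admissible_def)
    moreover have "es \<noteq> []" using es by (simp add: admissible_def)
    ultimately show ?case using es
      by (intro exI[of _ "es @ [(y, z)]"]) (simp add: admissible_append)
  qed
  have "(j, i) \<in> (edges \<tau>)\<^sup>*" using \<tau> i j by (simp add: MRDS_def irreducible_mrds_def)
  then have "(i, i) \<in> (edges \<tau>)\<^sup>+" using ij by (meson rtrancl_into_trancl2)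
  then show ?thesis using path that by blast
qed

text \<open>A loop at \<open>i\<close> yields a single non-injective surjection all of whose
  iterates lie in \<open>H_maps \<tau> i i\<close>; equicontinuity at every point would make it
  injective.\<close>

lemma Fatou_neq_UNIV:
  assumes \<tau>: "\<tau> \<in> MRDS X" and i: "i \<in> vertices \<tau>"
  shows "Fatou \<tau> i \<noteq> UNIV"
proof
  assume F: "Fatou \<tau> i = UNIV"
  obtain es where es: "admissible \<tau> es" "fst (hd es) = i" "snd (last es) = i"
    using exists_loop[OF assms] .
  define fs where "fs = map (\<lambda>e. SOME f. f \<in> edge_supp \<tau> e) es"
  have "(SOME f. f \<in> edge_supp \<tau> e) \<in> edge_supp \<tau> e" if "e \<in> set es" for e
    using MRDS_edge_supp(2)[OF \<tau>, of e] es(1) that by (auto simp: admissible_def some_in_eq)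
  then have "list_all2 (\<lambda>f e. f \<in> edge_supp \<tau> e) fs es"
    by (auto simp: fs_def list_all2_map1 list_all2_same)
  then have g: "compose_maps fs \<in> H_maps \<tau> i i"
    using es unfolding H_maps_def word_maps_def by blast
  have it: "compose_maps fs ^^ Suc n \<in> H_maps \<tau> i i" for n
  proof (induction n)
    case (Suc n)
    then show ?case unfolding funpow.simps(2)[of "Suc n"] by (rule H_maps_comp[OF _ g])
  qed (use g in simp)
  have "inj (compose_maps fs)"
  proof (rule equicontinuous_surj_imp_inj[OF compact_sphere surj_compose_maps])
    fix x and e :: real assume e: "e > 0"
    have "x \<in> Fatou \<tau> i" using F by simp
    then obtain U where U: "open U" "x \<in> U" "equicontinuous_on U (\<Union>j\<in>vertices \<tau>. H_maps \<tau> i j)"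
      unfolding Fatou_def by blast
    obtain d where d: "d > 0"
      "\<forall>h\<in>(\<Union>j\<in>vertices \<tau>. H_maps \<tau> i j). \<forall>y\<in>U. dist y x < d \<longrightarrow> dist (h y) (h x) < e"
      using U(2,3) e unfolding equicontinuous_on_def by meson
    obtain d' where d': "d' > 0" "\<And>y. dist y x < d' \<Longrightarrow> y \<in> U"
      using U(1,2) unfolding open_dist by blast
    have "dist ((compose_maps fs ^^ n) y) ((compose_maps fs ^^ n) x) < e"
      if "n > 0" "dist y x < min d d'" for n y
    proof -
      have "compose_maps fs ^^ n \<in> (\<Union>j\<in>vertices \<tau>. H_maps \<tau> i j)"
        using it[of "n - 1"] that(1) i by auto
      moreover have "y \<in> U" "dist y x < d" using d'(2)[of y] that(2) by simp_all
      ultimately show ?thesis using d(2) by blast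
    qed
    then show "\<exists>\<delta>>0. \<forall>n>0. \<forall>y. dist y x < \<delta> \<longrightarrow>
        dist ((compose_maps fs ^^ n) y) ((compose_maps fs ^^ n) x) < e"
      using d(1) d'(1) by (intro exI[of _ "min d d'"]) auto
  qed
  moreover have "fs \<noteq> []" using es(1) by (simp add: fs_def admissible_def)
  ultimately show False using not_inj_compose_maps by blast
qed

section \<open>Perturbation of words\<close>

lemma dist_rat_apply_le: "dist (rat_apply f z) (rat_apply g z) \<le> dist f g"
  unfolding dist_rat_plus_def
  by (intro cSUP_upper bdd_aboveI[of _ pi]) (auto simp: dist_sphere_le_pi)

text \<open>Compare through \<open>f0\<close>: the sup metric bounds the change of map, continuity
  of \<open>f0\<close> the change of point. On compact products this yields moduli common to a whole
  support.\<close>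

lemma continuous_on_rat_apply_prod: "continuous_on A (\<lambda>(f, x). rat_apply f x)"
proof -
  have "isCont (\<lambda>(f, x). rat_apply f x) (f0, x0)" for f0 x0
  proof -
    have "((\<lambda>z. dist (rat_apply (fst z) (snd z)) (rat_apply f0 x0)) \<longlongrightarrow> 0) (at (f0, x0))"
    proof (rule tendsto_sandwich[OF _ _ tendsto_const])
      show "\<forall>\<^sub>F z in at (f0, x0). dist (rat_apply (fst z) (snd z)) (rat_apply f0 x0)
          \<le> dist (fst z) f0 + dist (rat_apply f0 (snd z)) (rat_apply f0 x0)"
        by (intro always_eventually allI order_trans[OF dist_triangle add_right_mono[OF dist_rat_apply_le]])
      have "isCont (rat_apply f0) x0"
        using continuous_on_rat_apply[of UNIV f0] by (simp add: continuous_on_eq_continuous_at)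
      then have "((\<lambda>z. rat_apply f0 (snd z)) \<longlongrightarrow> rat_apply f0 x0) (at (f0, x0))"
        by (rule isCont_tendsto_compose) (auto intro!: tendsto_eq_intros)
      then have "((\<lambda>z. dist (fst z) f0 + dist (rat_apply f0 (snd z)) (rat_apply f0 x0))
          \<longlongrightarrow> dist (fst (f0, x0)) f0 + dist (rat_apply f0 x0) (rat_apply f0 x0)) (at (f0, x0))"
        by (intro tendsto_add tendsto_dist tendsto_fst tendsto_ident_at tendsto_const)
      then show "((\<lambda>z. dist (fst z) f0 + dist (rat_apply f0 (snd z)) (rat_apply f0 x0)) \<longlongrightarrow> 0) (at (f0, x0))"
        by simp
    qed auto
    then show ?thesis
      unfolding isCont_def case_prod_unfold tendsto_dist_iff[of "\<lambda>z. rat_apply (fst z) (snd z)"] by simp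
  qed
  then show ?thesis by (intro continuous_at_imp_continuous_on) (auto simp only: split_paired_all)
qed

lemma compact_uniformly_equicontinuous:
  assumes "compact G" "e > 0"
  obtains \<delta> where "\<delta> > 0" "\<forall>f\<in>G. \<forall>x y. dist x y < \<delta> \<longrightarrow> dist (rat_apply f x) (rat_apply f y) < e"
proof -
  have "uniformly_continuous_on (G \<times> UNIV) (\<lambda>(f, x). rat_apply f x)"
    by (intro compact_uniformly_continuous continuous_on_rat_apply_prod compact_Times assms compact_sphere)
  then obtain \<delta> where \<delta>: "\<delta> > 0" "\<forall>x\<in>G \<times> UNIV. \<forall>x'\<in>G \<times> UNIV. dist x' x < \<delta> \<longrightarrow>
      dist ((\<lambda>(f, x). rat_apply f x) x') ((\<lambda>(f, x). rat_apply f x) x) < e"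
    using assms(2) unfolding uniformly_continuous_on_def by meson
  have "dist (rat_apply f x) (rat_apply f y) < e" if "f \<in> G" "dist x y < \<delta>" for f x y
    using \<delta>(2)[rule_format, of "(f, y)" "(f, x)"] that by (simp add: dist_Pair_Pair)
  then show ?thesis using that \<delta>(1) by blast
qed

lemma compose_maps_uniformly_equicontinuous:
  assumes "compact G" "e > 0"
  shows "\<exists>\<delta>>0. \<forall>fs. length fs \<le> n \<and> set fs \<subseteq> G \<longrightarrow>
    (\<forall>x y. dist x y < \<delta> \<longrightarrow> dist (compose_maps fs x) (compose_maps fs y) < e)"
proof (induction n)
  case 0
  then show ?case using assms(2) by (intro exI[of _ e]) auto
next
  case (Suc n)
  then obtain \<delta> where \<delta>: "\<delta> > 0" "\<forall>fs. length fs \<le> n \<and> set fs \<subseteq> G \<longrightarrow>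
    (\<forall>x y. dist x y < \<delta> \<longrightarrow> dist (compose_maps fs x) (compose_maps fs y) < e)" by blast
  obtain \<delta>' where \<delta>': "\<delta>' > 0" "\<forall>f\<in>G. \<forall>x y. dist x y < \<delta>' \<longrightarrow> dist (rat_apply f x) (rat_apply f y) < \<delta>"
    using compact_uniformly_equicontinuous[OF assms(1) \<delta>(1)] .
  have "dist (compose_maps fs x) (compose_maps fs y) < e"
    if fs: "length fs \<le> Suc n" "set fs \<subseteq> G" and xy: "dist x y < min e \<delta>'" for fs x y
  proof (cases fs)
    case (Cons f gs)
    then have "dist (rat_apply f x) (rat_apply f y) < \<delta>" using \<delta>'(2) fs xy by auto
    then show ?thesis using \<delta>(2) fs Cons by auto
  qed (use xy in simp)
  then show ?case using assms(2) \<delta>'(1) by (intro exI[of _ "min e \<delta>'"]) auto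
qed

text \<open>Induction along the word: the images of \<open>C\<close> under the first set of maps
  form a compact set \<open>C2\<close>, from which the tail starts. The starting point must be
  allowed to move as well, because the error of the first map reaches the tail as a displaced
  starting point.\<close>

lemma compose_maps_perturb:
  assumes "\<forall>G\<in>set Gs. compact G" "compact C" "open U"
    and "\<And>gs c. list_all2 (\<in>) gs Gs \<Longrightarrow> c \<in> C \<Longrightarrow> compose_maps gs c \<in> U"
  shows "\<exists>\<eta>>0. \<forall>fs x. list_all2 (\<lambda>f G. \<exists>g\<in>G. dist f g < \<eta>) fs Gs \<and> (\<exists>c\<in>C. dist x c < \<eta>) \<longrightarrow>
    compose_maps fs x \<in> U"
  using assms
proof (induction Gs arbitrary: C)
  case Nil
  then have "C \<subseteq> U" by auto
  then obtain e where e: "e > 0" "(\<Union>x\<in>C. ball x e) \<subseteq> U"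
    using compact_subset_open_imp_ball_epsilon_subset[OF \<open>compact C\<close> \<open>open U\<close>] by blast
  then show ?case by (intro exI[of _ e]) (auto simp: dist_commute intro!: subsetD[OF e(2)])
next
  case (Cons G Gs)
  define C2 where "C2 = (\<lambda>(f, x). rat_apply f x) ` (G \<times> C)"
  have G: "compact G" "\<forall>G\<in>set Gs. compact G" using Cons.prems by auto
  have "compact C2" unfolding C2_def
    by (intro compact_continuous_image continuous_on_rat_apply_prod compact_Times G Cons.prems)
  moreover have "compose_maps gs c \<in> U" if gs: "list_all2 (\<in>) gs Gs" and c: "c \<in> C2" for gs c
  proof -
    obtain f x where "f \<in> G" "x \<in> C" "c = rat_apply f x" using c by (auto simp: C2_def)
    then show ?thesis using Cons.prems(4)[of "f # gs" x] gs by simp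
  qed
  ultimately have "\<exists>\<eta>>0. \<forall>fs x. list_all2 (\<lambda>f G. \<exists>g\<in>G. dist f g < \<eta>) fs Gs \<and>
      (\<exists>c\<in>C2. dist x c < \<eta>) \<longrightarrow> compose_maps fs x \<in> U"
    by (intro Cons.IH[OF G(2) _ \<open>open U\<close>])
  then obtain \<eta>2 where \<eta>2: "\<eta>2 > 0" "\<forall>fs x. list_all2 (\<lambda>f G. \<exists>g\<in>G. dist f g < \<eta>2) fs Gs \<and>
      (\<exists>c\<in>C2. dist x c < \<eta>2) \<longrightarrow> compose_maps fs x \<in> U"
    by (elim exE conjE)
  obtain \<delta> where \<delta>: "\<delta> > 0" "\<forall>f\<in>G. \<forall>x y. dist x y < \<delta> \<longrightarrow> dist (rat_apply f x) (rat_apply f y) < \<eta>2 / 2"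
    using compact_uniformly_equicontinuous[OF G(1), of "\<eta>2 / 2"] \<eta>2(1) by auto
  \<comment> \<open>Half of \<open>\<eta>2\<close> pays for replacing \<open>f\<close> by
    \<open>g\<close>, the other half for moving \<open>x\<close> to \<open>c\<close>.\<close>
  define \<eta> where "\<eta> = min \<delta> (\<eta>2 / 2)"
  have "compose_maps fs x \<in> U"
    if fs: "list_all2 (\<lambda>f G. \<exists>g\<in>G. dist f g < \<eta>) fs (G # Gs)" and x: "\<exists>c\<in>C. dist x c < \<eta>" for fs x
  proof -
    obtain f fs' where f: "fs = f # fs'" "\<exists>g\<in>G. dist f g < \<eta>" "list_all2 (\<lambda>f G. \<exists>g\<in>G. dist f g < \<eta>) fs' Gs"
      using fs by (auto simp: list_all2_Cons2)
    obtain g c where gc: "g \<in> G" "dist f g < \<eta>" "c \<in> C" "dist x c < \<eta>" using f(2) x by blast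
    have "dist (rat_apply f x) (rat_apply g x) < \<eta>2 / 2"
      using dist_rat_apply_le[of f x g] gc(2) by (simp add: \<eta>_def)
    moreover have "dist (rat_apply g x) (rat_apply g c) < \<eta>2 / 2"
      using \<delta>(2) gc by (simp add: \<eta>_def)
    ultimately have "dist (rat_apply f x) (rat_apply g c) < \<eta>2"
      using dist_triangle[of "rat_apply f x" "rat_apply g c" "rat_apply g x"] by simp
    moreover have "rat_apply g c \<in> C2" using gc by (auto simp: C2_def)
    moreover have "list_all2 (\<lambda>f G. \<exists>g\<in>G. dist f g < \<eta>2) fs' Gs"
      using f(3) by (rule list_all2_mono) (use \<eta>2(1) in \<open>force simp: \<eta>_def\<close>)
    ultimately have "compose_maps fs' (rat_apply f x) \<in> U" using \<eta>2(2) by blast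
    then show ?thesis by (simp add: f(1))
  qed
  moreover have "\<eta> > 0" using \<delta>(1) \<eta>2(1) by (simp add: \<eta>_def)
  ultimately show ?case by blast
qed

lemma finite_uniform_radius:
  fixes P :: "'a \<Rightarrow> real \<Rightarrow> bool"
  assumes "finite S" "\<And>x. x \<in> S \<Longrightarrow> \<exists>\<eta>>0. P x \<eta>"
    and mono: "\<And>x \<eta> \<eta>'. P x \<eta> \<Longrightarrow> 0 < \<eta>' \<Longrightarrow> \<eta>' \<le> \<eta> \<Longrightarrow> P x \<eta>'"
  shows "\<exists>\<eta>>0. \<forall>x\<in>S. P x \<eta>"
  using assms(1,2)
proof (induction S rule: finite_induct)
  case empty
  show ?case using zero_less_one by blast
next
  case (insert x S)
  then obtain \<eta> \<eta>' where "\<eta> > 0" "\<forall>y\<in>S. P y \<eta>" "\<eta>' > 0" "P x \<eta>'" by (metis insertCI)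
  then show ?case using mono by (intro exI[of _ "min \<eta> \<eta>'"]) (auto intro: mono)
qed

section \<open>Fatou sets\<close>

lemma open_sphere_contains_disc:
  assumes "open S" "S \<noteq> {}"
  obtains b \<rho> where "\<rho> > 0" "Pt ` ball b \<rho> \<subseteq> S"
proof -
  have fin: "\<exists>b \<rho>. \<rho> > 0 \<and> Pt ` ball b \<rho> \<subseteq> S" if "Pt b \<in> S" for b
  proof -
    have "open (Pt -` S)" by (rule open_vimage[OF assms(1) continuous_on_Pt])
    moreover have "b \<in> Pt -` S" using that by simp
    ultimately obtain \<rho> where "\<rho> > 0" "ball b \<rho> \<subseteq> Pt -` S" by (rule openE)
    then show ?thesis by blast
  qed
  obtain p where p: "p \<in> S" using assms(2) by blast
  show ?thesis
  proof (cases p)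
    case (Pt b)
    then show ?thesis using fin p that by blast
  next
    case Infty
    have "open ((\<lambda>z. sphere_inv (Pt z)) -` S)"
      by (rule open_vimage[OF assms(1) continuous_on_entire_lift[OF entire_lift_inv_Pt]])
    moreover have "0 \<in> (\<lambda>z. sphere_inv (Pt z)) -` S" using p Infty by simp
    ultimately obtain r where r: "r > 0" "ball 0 r \<subseteq> (\<lambda>z. sphere_inv (Pt z)) -` S"
      by (rule openE)
    \<comment> \<open>A nonzero chart value near \<open>0\<close> is a finite point of
      \<open>S\<close>, which brings back the first case.\<close>
    have "complex_of_real (r / 2) \<in> ball 0 r" using r(1) by simp
    then have "sphere_inv (Pt (complex_of_real (r / 2))) \<in> S" using r(2) by blast
    then have "Pt (1 / complex_of_real (r / 2)) \<in> S" using r(1) by (simp del: of_real_divide)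
    then show ?thesis using fin that by blast
  qed
qed

text \<open>Montel's theorem for the maps under consideration; omitting a disc instead of three points makes
  it elementary.\<close>

lemma compose_maps_equicontinuous_omitting:
  assumes "open W" "z0 \<in> W" "open D" "D \<noteq> {}" "e > 0"
  shows "\<exists>\<delta>>0. \<forall>fs. compose_maps fs ` W \<inter> D = {} \<longrightarrow>
    (\<forall>z. dist z z0 < \<delta> \<longrightarrow> dist (compose_maps fs z) (compose_maps fs z0) < e)"
proof -
  obtain b \<rho> where b: "\<rho> > 0" "Pt ` ball b \<rho> \<subseteq> D"
    using open_sphere_contains_disc[OF assms(3,4)] .
  obtain \<kappa> a where \<kappa>: "entire_lift \<kappa>" "\<kappa> a = z0"
    "\<forall>r>0. \<exists>\<delta>>0. \<forall>p. dist p z0 < \<delta> \<longrightarrow> p \<in> \<kappa> ` ball a r"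
    using sphere_chart[of z0] .
  have "open (\<kappa> -` W)" by (rule open_vimage[OF assms(1) continuous_on_entire_lift[OF \<kappa>(1)]])
  moreover have "a \<in> \<kappa> -` W" using \<kappa>(2) assms(2) by simp
  ultimately obtain r where r: "r > 0" "ball a r \<subseteq> \<kappa> -` W" by (rule openE)
  obtain \<delta>1 where \<delta>1: "\<delta>1 > 0" "\<forall>h. entire_lift h \<and> h ` ball a r \<inter> Pt ` ball b \<rho> = {} \<longrightarrow>
    (\<forall>z\<in>ball a \<delta>1. dist (h z) (h a) < e)"
    using equicontinuous_omitting_disc[OF r(1) b(1) assms(5), of a b] by (elim exE conjE)
  obtain \<delta> where \<delta>: "\<delta> > 0" "\<forall>p. dist p z0 < \<delta> \<longrightarrow> p \<in> \<kappa> ` ball a \<delta>1"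
    using \<kappa>(3) \<delta>1(1) by meson
  have "dist (compose_maps fs z) (compose_maps fs z0) < e"
    if fs: "compose_maps fs ` W \<inter> D = {}" and z: "dist z z0 < \<delta>" for fs z
  proof -
    have "(\<lambda>w. compose_maps fs (\<kappa> w)) ` ball a r \<inter> Pt ` ball b \<rho> = {}"
      using fs r(2) b(2) by blast
    with entire_lift_compose_maps[OF \<kappa>(1)] \<delta>1(2)
    have "\<forall>w\<in>ball a \<delta>1. dist (compose_maps fs (\<kappa> w)) (compose_maps fs (\<kappa> a)) < e" by blast
    then have "\<forall>w\<in>ball a \<delta>1. dist (compose_maps fs (\<kappa> w)) (compose_maps fs z0) < e"
      unfolding \<kappa>(2) .
    then show ?thesis using \<delta>(2) z by blast
  qed
  then show ?thesis using \<delta>(1) by blast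
qed

text \<open>Each block of \<open>N\<close> letters sends \<open>W'\<close> into \<open>W\<close>,
  hence back into \<open>W'\<close>. The factor \<open>Suc k\<close> leaves out the empty word,
  whose identity map need not send \<open>W'\<close> into \<open>W\<close>.\<close>

lemma word_iterate:
  assumes N: "N \<ge> 1" and W: "\<And>i. i \<in> vertices \<sigma> \<Longrightarrow> W i \<subseteq> W' i"
    and step: "\<And>es h. admissible \<sigma> es \<Longrightarrow> length es = N \<Longrightarrow> h \<in> word_maps \<sigma> es \<Longrightarrow>
      h ` W' (fst (hd es)) \<subseteq> W (snd (last es))"
    and "admissible \<sigma> es" "length es = Suc k * N" "list_all2 (\<lambda>f e. f \<in> edge_supp \<sigma> e) fs es"
  shows "compose_maps fs ` W' (fst (hd es)) \<subseteq> W (snd (last es))"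
  using assms(4-6)
proof (induction k arbitrary: es fs)
  case 0
  then show ?case by (intro step) (auto simp: word_maps_def)
next
  case (Suc k)
  define es1 es2 where "es1 = take N es" and "es2 = drop N es"
  define fs1 fs2 where "fs1 = take N fs" and "fs2 = drop N fs"
  have es: "es = es1 @ es2" and fs: "fs = fs1 @ fs2" by (simp_all add: es1_def es2_def fs1_def fs2_def)
  have len: "length es1 = N" "length es2 = Suc k * N" using Suc.prems(2) by (simp_all add: es1_def es2_def)
  then have ne: "es1 \<noteq> []" "es2 \<noteq> []" using N by auto
  have adm: "admissible \<sigma> es1" "admissible \<sigma> es2" "snd (last es1) = fst (hd es2)"
    using Suc.prems(1) admissible_append[OF ne, of \<sigma>] unfolding es by auto
  have f: "list_all2 (\<lambda>f e. f \<in> edge_supp \<sigma> e) fs1 es1" "list_all2 (\<lambda>f e. f \<in> edge_supp \<sigma> e) fs2 es2"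
    using Suc.prems(3) by (simp_all add: es1_def es2_def fs1_def fs2_def list_all2_takeI list_all2_dropI)
  have "compose_maps fs1 ` W' (fst (hd es1)) \<subseteq> W (snd (last es1))"
    using f(1) by (intro step adm len) (auto simp: word_maps_def)
  moreover have "W (snd (last es1)) \<subseteq> W' (fst (hd es2))"
    using W[of "fst (hd es2)"] admissible_vertices(1)[OF adm(2)] adm(3) by simp
  moreover have "compose_maps fs2 ` W' (fst (hd es2)) \<subseteq> W (snd (last es2))"
    by (rule Suc.IH[OF adm(2) len(2) f(2)])
  ultimately show ?case using ne by (auto simp: es fs)
qed

lemma finite_edges: "finite (edges \<tau>)"
  by (rule finite_subset[of _ "vertices \<tau> \<times> vertices \<tau>"]) (auto simp: edges_def vertices_def)

text \<open>A word consists of full blocks of length \<open>N\<close> and a shorter tail. The blocks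
  end in some \<open>W j\<close> and so omit the nonempty open complement of its closure, which
  makes them equicontinuous; the tails have bounded length over a compact set of maps.\<close>

lemma subset_Fatou:
  assumes \<sigma>: "\<sigma> \<in> MRDS X" and N: "N \<ge> 1" and W: "\<And>i. i \<in> vertices \<sigma> \<Longrightarrow> W i \<subseteq> W' i"
    and step: "\<And>es h. admissible \<sigma> es \<Longrightarrow> length es = N \<Longrightarrow> h \<in> word_maps \<sigma> es \<Longrightarrow>
      h ` W' (fst (hd es)) \<subseteq> W (snd (last es))"
    and op: "\<And>i. i \<in> vertices \<sigma> \<Longrightarrow> open (W' i)"
    and ne: "\<And>i. i \<in> vertices \<sigma> \<Longrightarrow> closure (W i) \<noteq> UNIV"
    and i: "i \<in> vertices \<sigma>"
  shows "W' i \<subseteq> Fatou \<sigma> i"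
proof -
  have "equicontinuous_on (W' i) (\<Union>j\<in>vertices \<sigma>. H_maps \<sigma> i j)"
    unfolding equicontinuous_on_def
  proof (intro ballI allI impI)
    fix x and e :: real assume x: "x \<in> W' i" and e: "e > 0"
    define G where "G = (\<Union>e\<in>edges \<sigma>. edge_supp \<sigma> e)"
    have "compact G"
      unfolding G_def using \<sigma> finite_edges by (intro compact_UN) (auto simp: MRDS_def)
    then obtain \<delta>1 where \<delta>1: "\<delta>1 > 0" "\<forall>fs. length fs \<le> N \<and> set fs \<subseteq> G \<longrightarrow>
        (\<forall>x y. dist x y < \<delta>1 \<longrightarrow> dist (compose_maps fs x) (compose_maps fs y) < e)"
      using compose_maps_uniformly_equicontinuous[OF _ e, of G N] by meson
    have "\<exists>\<delta>>0. \<forall>fs. compose_maps fs ` W' i \<inter> - closure (W j) = {} \<longrightarrow>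
      (\<forall>z. dist z x < \<delta> \<longrightarrow> dist (compose_maps fs z) (compose_maps fs x) < \<delta>1)"
      if "j \<in> vertices \<sigma>" for j
      using ne[OF that] by (intro compose_maps_equicontinuous_omitting op i x \<delta>1(1)) auto
    then have "\<exists>\<delta>>0. \<forall>j\<in>vertices \<sigma>. \<forall>fs. compose_maps fs ` W' i \<inter> - closure (W j) = {} \<longrightarrow>
      (\<forall>z. dist z x < \<delta> \<longrightarrow> dist (compose_maps fs z) (compose_maps fs x) < \<delta>1)"
      by (intro finite_uniform_radius) (auto simp: vertices_def)
    then obtain \<delta>2 where \<delta>2: "\<delta>2 > 0" "\<forall>j\<in>vertices \<sigma>. \<forall>fs.
        compose_maps fs ` W' i \<inter> - closure (W j) = {} \<longrightarrow>
        (\<forall>z. dist z x < \<delta>2 \<longrightarrow> dist (compose_maps fs z) (compose_maps fs x) < \<delta>1)"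
      by blast
    have "dist (h y) (h x) < e"
      if h: "h \<in> (\<Union>j\<in>vertices \<sigma>. H_maps \<sigma> i j)" and y: "dist y x < min \<delta>1 \<delta>2" for h y
    proof -
      obtain es fs where es: "admissible \<sigma> es" "fst (hd es) = i"
        "list_all2 (\<lambda>f e. f \<in> edge_supp \<sigma> e) fs es" "h = compose_maps fs"
        using h unfolding H_maps_def word_maps_def by blast
      \<comment> \<open>The largest multiple of \<open>N\<close> within the word. The tail is
        applied last, so its modulus \<open>\<delta>1\<close> is the accuracy demanded of the
        blocks.\<close>
      define n where "n = length es div N * N"
      define es1 es2 where "es1 = take n es" and "es2 = drop n es"
      define fs1 fs2 where "fs1 = take n fs" and "fs2 = drop n fs"
      have f: "list_all2 (\<lambda>f e. f \<in> edge_supp \<sigma> e) fs1 es1" "list_all2 (\<lambda>f e. f \<in> edge_supp \<sigma> e) fs2 es2"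
        using es(3) by (simp_all add: es1_def es2_def fs1_def fs2_def list_all2_takeI list_all2_dropI)
      have n: "n \<le> length es" unfolding n_def by simp
      have "length es - n < N"
        using N unfolding n_def by (simp add: minus_div_mult_eq_mod)
      then have "length fs2 \<le> N" using list_all2_lengthD[OF f(2)] by (simp add: es2_def)
      moreover have "set fs2 \<subseteq> G"
      proof
        fix g assume "g \<in> set fs2"
        then obtain k where k: "k < length fs2" "g = fs2 ! k" by (auto simp: in_set_conv_nth)
        then have "g \<in> edge_supp \<sigma> (es2 ! k)" using list_all2_nthD[OF f(2) k(1)] by simp
        moreover have "es2 ! k \<in> set es"
          using k(1) list_all2_lengthD[OF f(2)] by (simp add: es2_def)
        ultimately show "g \<in> G" using es(1) by (auto simp: G_def admissible_def)
      qed
      moreover have "dist (compose_maps fs1 y) (compose_maps fs1 x) < \<delta>1"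
      \<comment> \<open>Without a full block the head is the identity; this is why
        \<open>\<delta>1\<close> enters the minimum.\<close>
      proof (cases "length es div N")
        case 0
        then show ?thesis using y by (simp add: n_def fs1_def)
      next
        case (Suc k)
        have len: "length es1 = Suc k * N" using n Suc unfolding es1_def n_def by simp
        then have ne1: "es1 \<noteq> []" using N by auto
        have adm: "admissible \<sigma> es1"
        proof (cases "es2 = []")
          case True
          then show ?thesis using es(1) by (simp add: es1_def es2_def)
        next
          case False
          then show ?thesis
            using es(1) admissible_append[OF ne1 False, of \<sigma>] by (simp add: es1_def es2_def)
        qed
        have "hd es1 = hd es" using ne1 by (simp add: es1_def)
        moreover have "compose_maps fs1 ` W' (fst (hd es1)) \<subseteq> W (snd (last es1))"
          by (rule word_iterate[OF N _ _ adm len f(1)]; (rule W | rule step); assumption)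
        ultimately have "compose_maps fs1 ` W' i \<subseteq> W (snd (last es1))"
          using es(2) by simp
        then have "compose_maps fs1 ` W' i \<inter> - closure (W (snd (last es1))) = {}"
          using closure_subset by blast
        then show ?thesis
          using \<delta>2(2) admissible_vertices(2)[OF adm] y by auto
      qed
      ultimately have "dist (compose_maps fs2 (compose_maps fs1 y)) (compose_maps fs2 (compose_maps fs1 x)) < e"
        using \<delta>1(2) by blast
      moreover have "fs = fs1 @ fs2" by (simp add: fs1_def fs2_def)
      ultimately show ?thesis by (simp add: es(4))
    qed
    then show "\<exists>\<delta>>0. \<forall>h\<in>(\<Union>j\<in>vertices \<sigma>. H_maps \<sigma> i j). \<forall>y\<in>W' i. dist y x < \<delta> \<longrightarrow> dist (h y) (h x) < e"
      using \<delta>1(1) \<delta>2(1) by (intro exI[of _ "min \<delta>1 \<delta>2"]) auto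
  qed
  then show ?thesis using op[OF i] unfolding Fatou_def by blast
qed

section \<open>Stability under perturbation\<close>

lemma hausdorff_dist_commute: "hausdorff_dist A B = hausdorff_dist B A"
  by (simp add: hausdorff_dist_def max.commute)

lemma hausdorff_dist_lessD:
  assumes "hausdorff_dist A B < \<eta>" "bounded A" "B \<noteq> {}" "x \<in> A"
  shows "\<exists>y\<in>B. dist x y < \<eta>"
proof -
  have "infdist x B \<le> (SUP x\<in>A. infdist x B)"
    by (rule cSUP_upper[OF assms(4) bdd_above_infdist[OF assms(2)]])
  also have "\<dots> < \<eta>" using assms(1) by (simp add: hausdorff_dist_def)
  finally have "(INF y\<in>B. dist x y) < \<eta>" by (simp add: infdist_notempty[OF assms(3)])
  then show ?thesis using assms(3) by (subst (asm) cINF_less_iff) auto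
qed

lemma list_all2_transfer_near:
  assumes "list_all2 (\<lambda>g e. g \<in> A e) gs es" "\<And>e g. e \<in> set es \<Longrightarrow> g \<in> A e \<Longrightarrow> \<exists>f\<in>B e. dist f g < \<eta>"
  shows "\<exists>fs. list_all2 (\<lambda>f e. f \<in> B e) fs es \<and> list_all2 (\<lambda>f g. dist f g < \<eta>) fs gs"
  using assms
proof (induction rule: list_all2_induct)
  case (Cons g gs e es)
  then obtain fs where fs: "list_all2 (\<lambda>f e. f \<in> B e) fs es" "list_all2 (\<lambda>f g. dist f g < \<eta>) fs gs"
    by (meson list.set_intros(2))
  obtain f where "f \<in> B e" "dist f g < \<eta>" using Cons by (meson list.set_intros(1))
  then show ?case using fs by (intro exI[of _ "f # fs"]) simp
qed simp

lemma word_maps_perturb: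
  assumes "compact C" "open U" "\<And>e. e \<in> set es \<Longrightarrow> compact (edge_supp \<tau> e)"
    and "\<And>h. h \<in> word_maps \<tau> es \<Longrightarrow> h ` C \<subseteq> U"
  shows "\<exists>\<eta>>0. \<forall>fs x. list_all2 (\<lambda>f e. \<exists>g\<in>edge_supp \<tau> e. dist f g < \<eta>) fs es \<and>
    (\<exists>c\<in>C. dist x c < \<eta>) \<longrightarrow> compose_maps fs x \<in> U"
proof -
  have "\<exists>\<eta>>0. \<forall>fs x. list_all2 (\<lambda>f G. \<exists>g\<in>G. dist f g < \<eta>) fs (map (edge_supp \<tau>) es) \<and>
    (\<exists>c\<in>C. dist x c < \<eta>) \<longrightarrow> compose_maps fs x \<in> U"
  proof (rule compose_maps_perturb[OF _ assms(1,2)])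
    show "compose_maps gs c \<in> U" if "list_all2 (\<in>) gs (map (edge_supp \<tau>) es)" "c \<in> C" for gs c
    proof -
      have "compose_maps gs \<in> word_maps \<tau> es"
        using that(1) by (auto simp: word_maps_def list_all2_map2)
      then show ?thesis using assms(4) that(2) by blast
    qed
  qed (use assms(3) in auto)
  then show ?thesis by (simp add: list_all2_map2)
qed

text \<open>A word that takes \<open>z\<close> into an open \<open>W j\<close> also works for nearby
  starting points under nearby maps. Finitely many such neighbourhoods cover the sphere, and the
  least of their radii serves every point.\<close>

lemma reaching_perturb:
  assumes reach: "\<And>z. \<exists>j\<in>vertices \<tau>. \<exists>h\<in>H_maps \<tau> i j. h z \<in> W j"
    and op: "\<And>j. j \<in> vertices \<tau> \<Longrightarrow> open (W j)"
  shows "\<exists>\<eta>>0. \<forall>z. \<exists>es gs. admissible \<tau> es \<and> fst (hd es) = i \<and>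
    list_all2 (\<lambda>g e. g \<in> edge_supp \<tau> e) gs es \<and>
    (\<forall>fs. list_all2 (\<lambda>f g. dist f g < \<eta>) fs gs \<longrightarrow> compose_maps fs z \<in> W (snd (last es)))"
proof -
  define P where "P z es gs \<eta> \<longleftrightarrow> admissible \<tau> es \<and> fst (hd es) = i \<and>
    list_all2 (\<lambda>g e. g \<in> edge_supp \<tau> e) gs es \<and>
    (\<forall>fs x. list_all2 (\<lambda>f g. dist f g < \<eta>) fs gs \<and> dist x z < \<eta> \<longrightarrow>
      compose_maps fs x \<in> W (snd (last es)))" for z es gs and \<eta> :: real
  have "\<exists>es gs \<eta>. \<eta> > 0 \<and> P z es gs \<eta>" for z
  proof -
    obtain j h where j: "j \<in> vertices \<tau>" "h \<in> H_maps \<tau> i j" "h z \<in> W j" using reach by blast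
    then obtain es gs where es: "admissible \<tau> es" "fst (hd es) = i" "snd (last es) = j"
      "list_all2 (\<lambda>g e. g \<in> edge_supp \<tau> e) gs es" "h = compose_maps gs"
      unfolding H_maps_def word_maps_def by blast
    \<comment> \<open>Singletons replace the supports here: one chosen path is to be followed, not
      every path along the word.\<close>
    have "\<exists>\<eta>>0. \<forall>fs x. list_all2 (\<lambda>f G. \<exists>g\<in>G. dist f g < \<eta>) fs (map (\<lambda>g. {g}) gs) \<and>
      (\<exists>c\<in>{z}. dist x c < \<eta>) \<longrightarrow> compose_maps fs x \<in> W j"
    proof (rule compose_maps_perturb)
      show "compose_maps gs' c \<in> W j" if "list_all2 (\<in>) gs' (map (\<lambda>g. {g}) gs)" "c \<in> {z}" for gs' c
      proof -
        have "gs' = gs" using that(1) by (simp add: list_all2_map2 list_all2_eq)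
        then show ?thesis using that(2) j(3) es(5) by simp
      qed
    qed (use op j(1) in auto)
    then obtain \<eta> where "\<eta> > 0" "P z es gs \<eta>"
      using es unfolding P_def by (auto simp: list_all2_map2)
    then show ?thesis by blast
  qed
  then obtain es gs \<eta> where P: "\<And>z. \<eta> z > 0 \<and> P z (es z) (gs z) (\<eta> z)" by metis
  have "z \<in> (\<Union>z. ball z (\<eta> z))" for z
    using P[of z] by (intro UN_I[of z]) auto
  then have cover: "UNIV \<subseteq> (\<Union>z. ball z (\<eta> z))" by blast
  obtain D where D: "finite D" "UNIV \<subseteq> (\<Union>z\<in>D. ball z (\<eta> z))"
    by (rule compactE_image[OF compact_sphere open_ball cover])
  have "\<exists>r>0. \<forall>z\<in>D. r \<le> \<eta> z"
    using D(1) P by (intro finite_uniform_radius) auto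
  then obtain r where r: "r > 0" "\<And>z. z \<in> D \<Longrightarrow> r \<le> \<eta> z" by blast
  have "\<exists>es gs. admissible \<tau> es \<and> fst (hd es) = i \<and>
    list_all2 (\<lambda>g e. g \<in> edge_supp \<tau> e) gs es \<and>
    (\<forall>fs. list_all2 (\<lambda>f g. dist f g < r) fs gs \<longrightarrow> compose_maps fs x \<in> W (snd (last es)))" for x
  proof -
    have "x \<in> (\<Union>z\<in>D. ball z (\<eta> z))" using D(2) by blast
    then obtain z where z: "z \<in> D" "dist x z < \<eta> z" by (auto simp: dist_commute)
    have "compose_maps fs x \<in> W (snd (last (es z)))" if "list_all2 (\<lambda>f g. dist f g < r) fs (gs z)" for fs
    proof -
      have "list_all2 (\<lambda>f g. dist f g < \<eta> z) fs (gs z)"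
        using that by (rule list_all2_mono) (use r(2)[OF z(1)] in simp)
      then show ?thesis using P[of z] z(2) unfolding P_def by blast
    qed
    then show ?thesis using P[of z] unfolding P_def by blast
  qed
  then show ?thesis using r(1) by blast
qed

lemma mean_stable_perturb:
  assumes \<tau>: "\<tau> \<in> MRDS X" and "mean_stable \<tau>"
  shows "\<exists>\<eta>>0. \<forall>\<sigma>\<in>MRDS X. mrds_graph \<sigma> = mrds_graph \<tau> \<and>
    (\<forall>e\<in>edges \<tau>. hausdorff_dist (edge_supp \<sigma> e) (edge_supp \<tau> e) < \<eta>) \<longrightarrow> mean_stable \<sigma>"
proof -
  obtain N U W where N: "N \<ge> 1"
    and op: "\<forall>i\<in>vertices \<tau>. open (U i) \<and> U i \<noteq> {} \<and> open (W i) \<and> W i \<noteq> {}"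
    and sub: "\<forall>i\<in>vertices \<tau>. closure (U i) \<subseteq> W i \<and> closure (W i) \<subseteq> Fatou \<tau> i"
    and step: "\<forall>es. admissible \<tau> es \<and> length es = N \<longrightarrow>
        (\<forall>h\<in>word_maps \<tau> es. closure (h ` W (fst (hd es))) \<subseteq> U (snd (last es)))"
    and reach: "\<forall>z. \<forall>i\<in>vertices \<tau>. \<exists>j\<in>vertices \<tau>. \<exists>h\<in>H_maps \<tau> i j. h z \<in> W j"
    using assms(2) unfolding mean_stable_def by blast
  have UW: "U i \<subseteq> W i" if "i \<in> vertices \<tau>" for i
    using sub that closure_subset by blast
  \<comment> \<open>Starting points near the closure of \<open>W\<close> are included, not only
    those in \<open>W\<close>; this provides the room for \<open>W'\<close>.\<close>
  define Q where "Q es \<eta> \<longleftrightarrow> (\<forall>fs x. list_all2 (\<lambda>f e. \<exists>g\<in>edge_supp \<tau> e. dist f g < \<eta>) fs es \<and>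
    (\<exists>c\<in>closure (W (fst (hd es))). dist x c < \<eta>) \<longrightarrow> compose_maps fs x \<in> U (snd (last es)))"
    for es and \<eta> :: real
  define R where "R i \<eta> \<longleftrightarrow> (\<forall>z. \<exists>es gs. admissible \<tau> es \<and> fst (hd es) = i \<and>
    list_all2 (\<lambda>g e. g \<in> edge_supp \<tau> e) gs es \<and>
    (\<forall>fs. list_all2 (\<lambda>f g. dist f g < \<eta>) fs gs \<longrightarrow> compose_maps fs z \<in> W (snd (last es))))"
    for i and \<eta> :: real
  have "\<exists>\<eta>>0. \<forall>es\<in>{es. set es \<subseteq> edges \<tau> \<and> length es = N}. admissible \<tau> es \<longrightarrow> Q es \<eta>"
  proof (rule finite_uniform_radius[OF finite_lists_length_eq[OF finite_edges]])
    fix es assume "es \<in> {es. set es \<subseteq> edges \<tau> \<and> length es = N}"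
    then have es: "set es \<subseteq> edges \<tau>" "length es = N" by auto
    show "\<exists>\<eta>>0. admissible \<tau> es \<longrightarrow> Q es \<eta>"
    proof (cases "admissible \<tau> es")
      case True
      have "\<exists>\<eta>>0. Q es \<eta>"
        unfolding Q_def
      proof (rule word_maps_perturb)
        show "compact (closure (W (fst (hd es))))"
          using closed_Int_compact[OF closed_closure compact_sphere] by simp
        show "open (U (snd (last es)))"
          using op admissible_vertices(2)[OF True] by blast
        show "compact (edge_supp \<tau> e)" if "e \<in> set es" for e
          using \<tau> es that by (auto simp: MRDS_def)
        show "h ` closure (W (fst (hd es))) \<subseteq> U (snd (last es))" if h: "h \<in> word_maps \<tau> es" for h
        proof -
          obtain fs where "h = compose_maps fs" using h by (auto simp: word_maps_def)
          \<comment> \<open>By continuity the contraction condition extends from \<open>W\<close> to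
            its compact closure, as the perturbation lemma requires.\<close>
          then have "h ` closure (W (fst (hd es))) \<subseteq> closure (h ` W (fst (hd es)))"
            by (simp add: image_closure_subset closure_subset continuous_on_compose_maps)
          then show ?thesis using step True es(2) h by blast
        qed
      qed
      then show ?thesis by blast
    qed (auto intro: exI[of _ 1])
  next
    fix es and \<eta> \<eta>' :: real assume Q: "admissible \<tau> es \<longrightarrow> Q es \<eta>" and le: "\<eta>' \<le> \<eta>"
    have "list_all2 (\<lambda>f e. \<exists>g\<in>edge_supp \<tau> e. dist f g < \<eta>') fs es \<Longrightarrow>
      list_all2 (\<lambda>f e. \<exists>g\<in>edge_supp \<tau> e. dist f g < \<eta>) fs es" for fs
      by (erule list_all2_mono) (use le in force)
    moreover have "(\<exists>c\<in>C. dist x c < \<eta>') \<Longrightarrow> (\<exists>c\<in>C. dist x c < \<eta>)" for x :: riemann_sphere and C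
      using le by force
    ultimately show "admissible \<tau> es \<longrightarrow> Q es \<eta>'" using Q unfolding Q_def by blast
  qed
  then obtain \<eta>1 where \<eta>1: "\<eta>1 > 0" "\<And>es. admissible \<tau> es \<Longrightarrow> length es = N \<Longrightarrow> Q es \<eta>1"
    unfolding admissible_def by blast
  have "\<exists>\<eta>>0. \<forall>i\<in>vertices \<tau>. R i \<eta>"
  proof (rule finite_uniform_radius)
    show "finite (vertices \<tau>)" by (simp add: vertices_def)
    show "\<exists>\<eta>>0. R i \<eta>" if "i \<in> vertices \<tau>" for i
      unfolding R_def using reach op that by (intro reaching_perturb) auto
  next
    fix i and \<eta> \<eta>' :: real assume R: "R i \<eta>" and le: "\<eta>' \<le> \<eta>"
    have "list_all2 (\<lambda>f g. dist f g < \<eta>') fs gs \<Longrightarrow> list_all2 (\<lambda>f g. dist f g < \<eta>) fs gs"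
      for fs gs :: "rat_plus list"
      by (erule list_all2_mono) (use le in simp)
    then show "R i \<eta>'" using R unfolding R_def by meson
  qed
  then obtain \<eta>2 where \<eta>2: "\<eta>2 > 0" "\<And>i. i \<in> vertices \<tau> \<Longrightarrow> R i \<eta>2" by blast
  define \<eta> where "\<eta> = min \<eta>1 \<eta>2"
  have "mean_stable \<sigma>" if \<sigma>: "\<sigma> \<in> MRDS X" and gr: "mrds_graph \<sigma> = mrds_graph \<tau>"
    and near: "\<forall>e\<in>edges \<tau>. hausdorff_dist (edge_supp \<sigma> e) (edge_supp \<tau> e) < \<eta>" for \<sigma>
  proof -
    have V: "vertices \<sigma> = vertices \<tau>" and E: "edges \<sigma> = edges \<tau>" using gr by (simp_all add: mrds_graph_def)
    then have adm: "admissible \<sigma> = admissible \<tau>" by (simp add: admissible_def fun_eq_iff)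
    \<comment> \<open>The two halves of Hausdorff closeness have different uses. Contraction
      concerns all maps of \<sigma>, so each of them needs a neighbour in \<tau>.\<close>
    have near1: "\<exists>g\<in>edge_supp \<tau> e. dist f g < \<eta>" if "e \<in> edges \<tau>" "f \<in> edge_supp \<sigma> e" for e f
      using near that MRDS_edge_supp[OF \<tau>, of e] MRDS_edge_supp[OF \<sigma>, of e]
      by (intro hausdorff_dist_lessD[of "edge_supp \<sigma> e"]) (auto simp: E)
    \<comment> \<open>Reachability asks for one path in \<sigma>, obtained by approximating the maps
      of a path in \<tau>.\<close>
    have near2: "\<exists>f\<in>edge_supp \<sigma> e. dist f g < \<eta>" if "e \<in> edges \<tau>" "g \<in> edge_supp \<tau> e" for e g
      using near that MRDS_edge_supp[OF \<tau>, of e] MRDS_edge_supp[OF \<sigma>, of e]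
        hausdorff_dist_lessD[of "edge_supp \<tau> e" "edge_supp \<sigma> e" \<eta> g]
      by (auto simp: E hausdorff_dist_commute dist_commute)
    define W' where "W' i = (\<Union>c\<in>closure (W i). ball c \<eta>1)" for i
    have WW': "closure (W i) \<subseteq> W' i" for i using \<eta>1(1) by (auto simp: W'_def)
    have step': "h ` W' (fst (hd es)) \<subseteq> U (snd (last es))"
      if es: "admissible \<sigma> es" "length es = N" and h: "h \<in> word_maps \<sigma> es" for es h
    proof -
      obtain fs where fs: "h = compose_maps fs" "list_all2 (\<lambda>f e. f \<in> edge_supp \<sigma> e) fs es"
        using h by (auto simp: word_maps_def)
      have "set es \<subseteq> edges \<tau>" using es(1) by (simp add: admissible_def E)
      then have "list_all2 (\<lambda>f e. \<exists>g\<in>edge_supp \<tau> e. dist f g < \<eta>1) fs es"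
        using fs(2) near1 unfolding list_all2_conv_all_nth \<eta>_def
        by (metis min_less_iff_conj nth_mem subsetD)
      moreover have "Q es \<eta>1" using \<eta>1(2) es by (simp add: adm)
      moreover have "\<exists>c\<in>closure (W (fst (hd es))). dist x c < \<eta>1" if "x \<in> W' (fst (hd es))" for x
        using that by (auto simp: W'_def dist_commute)
      ultimately have "compose_maps fs x \<in> U (snd (last es))" if "x \<in> W' (fst (hd es))" for x
        using that unfolding Q_def by blast
      then show ?thesis by (auto simp: fs(1))
    qed
    have F: "closure (W i) \<subseteq> Fatou \<sigma> i" if i: "i \<in> vertices \<tau>" for i
    proof -
      have "W' i \<subseteq> Fatou \<sigma> i"
      proof (rule subset_Fatou[OF \<sigma> N])
        show "W i \<subseteq> W' i" for i using WW' closure_subset by blast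
        show "h ` W' (fst (hd es)) \<subseteq> W (snd (last es))"
          if es: "admissible \<sigma> es" "length es = N" and h: "h \<in> word_maps \<sigma> es" for es h
          using step'[OF es h] UW[of "snd (last es)"] admissible_vertices(2)[OF es(1)] V by auto
        show "open (W' i)" for i by (auto simp: W'_def)
        \<comment> \<open>Here the Fatou set of \<tau> is used, since that of \<sigma> is still
          being determined.\<close>
        show "closure (W i) \<noteq> UNIV" if "i \<in> vertices \<sigma>" for i
          using sub Fatou_neq_UNIV[OF \<tau>, of i] that V by (metis top.extremum_unique)
      qed (use i V in simp)
      then show ?thesis using WW' by blast
    qed
    have step'': "closure (h ` W (fst (hd es))) \<subseteq> U (snd (last es))"
      if es: "admissible \<sigma> es" "length es = N" and h: "h \<in> word_maps \<sigma> es" for es h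
    proof -
      obtain fs where fs: "h = compose_maps fs" using h by (auto simp: word_maps_def)
      have "compact (closure (W (fst (hd es))))"
        using closed_Int_compact[OF closed_closure compact_sphere] by simp
      then have "compact (h ` closure (W (fst (hd es))))"
        unfolding fs by (intro compact_continuous_image continuous_on_compose_maps)
      then have "closure (h ` W (fst (hd es))) \<subseteq> h ` closure (W (fst (hd es)))"
        by (intro closure_minimal image_mono closure_subset compact_imp_closed)
      then show ?thesis using step'[OF es h] WW' by blast
    qed
    have reach': "\<exists>j\<in>vertices \<sigma>. \<exists>h\<in>H_maps \<sigma> i j. h z \<in> W j" if i: "i \<in> vertices \<tau>" for z i
    proof -
      obtain es gs where es: "admissible \<tau> es" "fst (hd es) = i"
        "list_all2 (\<lambda>g e. g \<in> edge_supp \<tau> e) gs es"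
        "\<forall>fs. list_all2 (\<lambda>f g. dist f g < \<eta>2) fs gs \<longrightarrow> compose_maps fs z \<in> W (snd (last es))"
        using \<eta>2(2)[OF i] unfolding R_def by blast
      have sub: "set es \<subseteq> edges \<tau>" using es(1) by (simp add: admissible_def)
      have "\<exists>f\<in>edge_supp \<sigma> e. dist f g < \<eta>2" if "e \<in> set es" "g \<in> edge_supp \<tau> e" for e g
        using near2[of e g] sub that by (auto simp: \<eta>_def)
      then have "\<exists>fs. list_all2 (\<lambda>f e. f \<in> edge_supp \<sigma> e) fs es \<and> list_all2 (\<lambda>f g. dist f g < \<eta>2) fs gs"
        by (rule list_all2_transfer_near[OF es(3)])
      then obtain fs where fs: "list_all2 (\<lambda>f e. f \<in> edge_supp \<sigma> e) fs es" "list_all2 (\<lambda>f g. dist f g < \<eta>2) fs gs"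
        by (elim exE conjE)
      have "compose_maps fs \<in> H_maps \<sigma> i (snd (last es))"
        using es(1,2) fs(1) unfolding H_maps_def word_maps_def adm by blast
      moreover have "snd (last es) \<in> vertices \<sigma>" using admissible_vertices(2)[OF es(1)] V by simp
      ultimately show ?thesis using es(4) fs(2) by blast
    qed
    show ?thesis
      unfolding mean_stable_def V
      using N op sub F step'' reach' V
      by (intro exI[of _ N] exI[of _ U] exI[of _ W]) blast
  qed
  moreover have "\<eta> > 0" using \<eta>1(1) \<eta>2(1) by (simp add: \<eta>_def)
  ultimately show ?thesis by blast
qed

section \<open>Counting bifurcation parameters\<close>

text \<open>The radius of stability is expressed by the graph and one Hausdorff condition per edge.
  These are finitely many subbasic open sets, so they pull back to a neighbourhood of
  \<open>l\<close>. Closedness makes Bif_s a Borel set.\<close>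

lemma closed_Bif:
  fixes \<Phi> :: "'l::topological_space \<times> real \<Rightarrow> mrds"
  assumes cont: "continuous_map (prod_topology euclidean (top_of_set I)) (mrds_topology X) \<Phi>"
    and s: "s \<in> I"
  shows "closed {l. \<not> mean_stable (\<Phi> (l, s))}"
proof -
  have M: "\<Phi> (l, s) \<in> MRDS X" for l
    using cont s by (auto simp: continuous_map_def topspace_mrds_topology)
  have "continuous_map euclidean (prod_topology euclidean (top_of_set I)) (\<lambda>l. (l, s))"
    by (intro continuous_map_pairedI) (use s in auto)
  from continuous_map_compose[OF this cont]
  have cont': "continuous_map euclidean (mrds_topology X) (\<lambda>l. \<Phi> (l, s))" by (simp add: o_def)
  have "\<exists>T. open T \<and> l \<in> T \<and> T \<subseteq> {l. mean_stable (\<Phi> (l, s))}" if st: "mean_stable (\<Phi> (l, s))" for l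
  proof -
    define \<tau> where "\<tau> = \<Phi> (l, s)"
    have \<tau>: "\<tau> \<in> MRDS X" using M by (simp add: \<tau>_def)
    obtain \<eta> where \<eta>: "\<eta> > 0" "\<forall>\<sigma>\<in>MRDS X. mrds_graph \<sigma> = mrds_graph \<tau> \<and>
        (\<forall>e\<in>edges \<tau>. hausdorff_dist (edge_supp \<sigma> e) (edge_supp \<tau> e) < \<eta>) \<longrightarrow> mean_stable \<sigma>"
      using mean_stable_perturb[OF \<tau> st[folded \<tau>_def]] by (elim exE conjE)
    define S where "S e = {\<sigma> \<in> MRDS X. e \<in> edges \<sigma> \<and>
        hausdorff_dist (edge_supp \<sigma> e) (edge_supp \<tau> e) < \<eta>}" for e
    define G where "G = {\<sigma> \<in> MRDS X. mrds_graph \<sigma> = mrds_graph \<tau>}"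
    define T where "T = (\<lambda>l. \<Phi> (l, s)) -` G \<inter> (\<Inter>e\<in>edges \<tau>. (\<lambda>l. \<Phi> (l, s)) -` S e)"
    have vim: "open ((\<lambda>l. \<Phi> (l, s)) -` A)" if "A \<in> mrds_subbasis X" for A
    proof -
      have "openin (mrds_topology X) A"
        unfolding mrds_topology_def using that by (rule topology_generated_by_Basis)
      from openin_continuous_map_preimage[OF cont' this]
      show ?thesis by (simp add: vimage_def)
    qed
    have "open T"
      unfolding T_def S_def G_def using \<tau> finite_edges
      by (intro open_Int open_INT ballI vim mrds_subbasisI) auto
    moreover have "l \<in> T"
      using \<tau> \<eta>(1) MRDS_edge_supp(2)[OF \<tau>] by (auto simp: T_def S_def G_def \<tau>_def[symmetric] hausdorff_dist_self)
    moreover have "T \<subseteq> {l. mean_stable (\<Phi> (l, s))}"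
    proof
      fix l' assume "l' \<in> T"
      then have "\<Phi> (l', s) \<in> G" "\<forall>e\<in>edges \<tau>. \<Phi> (l', s) \<in> S e" unfolding T_def by auto
      then show "l' \<in> {l. mean_stable (\<Phi> (l, s))}" using \<eta>(2) unfolding S_def G_def by simp
    qed
    ultimately show ?thesis by blast
  qed
  then have "open {l. mean_stable (\<Phi> (l, s))}" by (subst open_subopen) auto
  then show ?thesis unfolding closed_def by (simp add: Collect_neg_eq)
qed

text \<open>Integrate the pointwise bound: the indicators of the sets \<open>B s \<inter> A\<close>
  add up to at most \<alpha> times the indicator of \<open>A\<close>.\<close>

lemma sum_emeasure_le_overlap:
  assumes "finite F" "\<And>s. s \<in> F \<Longrightarrow> B s \<in> sets m" "A \<in> sets m"
    and "\<And>x. card {s \<in> F. x \<in> B s} \<le> \<alpha>"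
  shows "(\<Sum>s\<in>F. emeasure m (B s \<inter> A)) \<le> of_nat \<alpha> * emeasure m A"
proof -
  have "(\<Sum>s\<in>F. emeasure m (B s \<inter> A)) = (\<Sum>s\<in>F. \<integral>\<^sup>+ x. indicator (B s \<inter> A) x \<partial>m)"
    using assms(2,3) by (intro sum.cong) auto
  also have "\<dots> = (\<integral>\<^sup>+ x. (\<Sum>s\<in>F. indicator (B s \<inter> A) x) \<partial>m)"
    using assms(2,3) by (intro nn_integral_sum[symmetric]) auto
  also have "\<dots> \<le> (\<integral>\<^sup>+ x. of_nat \<alpha> * indicator A x \<partial>m)"
  proof (rule nn_integral_mono)
    fix x
    have "(\<Sum>s\<in>F. indicator (B s \<inter> A) x) = (\<Sum>s\<in>F. indicator (B s) x) * (indicator A x :: ennreal)"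
      by (simp add: sum_distrib_right indicator_inter_arith)
    also have "(\<Sum>s\<in>F. indicator (B s) x :: ennreal) = of_nat (card {s \<in> F. x \<in> B s})"
      using assms(1) by (simp add: indicator_def sum.If_cases Int_def)
    also have "\<dots> * indicator A x \<le> of_nat \<alpha> * indicator A x"
      using assms(4) by (intro mult_right_mono) auto
    finally show "(\<Sum>s\<in>F. indicator (B s \<inter> A) x) \<le> of_nat \<alpha> * (indicator A x :: ennreal)" .
  qed
  also have "\<dots> = of_nat \<alpha> * emeasure m A"
    using assms(3) by (simp add: nn_integral_cmult_indicator)
  finally show ?thesis .
qed

text \<open>A non-null \<open>B s\<close> meets some piece \<open>A n\<close> of finite measure in
  measure above \<open>1 / Suc k\<close> for some \<open>k\<close>, and for fixed \<open>n\<close>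
  and \<open>k\<close> the overlap bound admits finitely many such \<open>s\<close>. Finiteness is
  stated beside the bound on \<open>card\<close> because infinite sets have \<open>card\<close>
  0.\<close>

lemma countable_positive_bounded_overlap:
  assumes "sigma_finite_measure m" "\<And>s. s \<in> I \<Longrightarrow> B s \<in> sets m"
    and ov: "\<And>x. finite {s \<in> I. x \<in> B s} \<and> card {s \<in> I. x \<in> B s} \<le> \<alpha>"
  shows "countable {s \<in> I. B s \<notin> null_sets m}"
proof -
  interpret sigma_finite_measure m by fact
  obtain A :: "nat \<Rightarrow> _" where A: "range A \<subseteq> sets m" "(\<Union>i. A i) = space m" "\<And>i. emeasure m (A i) \<noteq> \<infinity>"
    using sigma_finite by blast
  define S where "S n k = {s \<in> I. emeasure m (B s \<inter> A n) > ennreal (1 / real (Suc k))}" for n k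
  have "finite (S n k)" for n k
  proof -
    \<comment> \<open>From \<open>card F / Suc k \<le> \<alpha> * measure m (A n)\<close>, rounded
      up to a natural number.\<close>
    define c where "c = nat \<lceil>of_nat \<alpha> * measure m (A n) * real (Suc k)\<rceil>"
    have "card F \<le> c" if F: "F \<subseteq> S n k" "finite F" for F
    proof -
      have FI: "F \<subseteq> I" using F(1) by (auto simp: S_def)
      have "card {s \<in> F. x \<in> B s} \<le> \<alpha>" for x
      proof -
        have "{s \<in> F. x \<in> B s} \<subseteq> {s \<in> I. x \<in> B s}" using FI by blast
        then show ?thesis using card_mono ov[of x] by (meson order_trans)
      qed
      then have "(\<Sum>s\<in>F. emeasure m (B s \<inter> A n)) \<le> of_nat \<alpha> * emeasure m (A n)"
        using F(2) FI assms(2) A(1) by (intro sum_emeasure_le_overlap) auto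
      moreover have "(\<Sum>s\<in>F. ennreal (1 / real (Suc k))) \<le> (\<Sum>s\<in>F. emeasure m (B s \<inter> A n))"
        using F(1) by (intro sum_mono) (auto simp: S_def)
      ultimately have "of_nat (card F) * ennreal (1 / real (Suc k)) \<le> of_nat \<alpha> * emeasure m (A n)"
        by (simp del: of_nat_Suc)
      also have "of_nat (card F) * ennreal (1 / real (Suc k)) = ennreal (real (card F) * (1 / real (Suc k)))"
        by (simp add: ennreal_of_nat_eq_real_of_nat del: of_nat_Suc flip: ennreal_mult)
      also have "of_nat \<alpha> * emeasure m (A n) = ennreal (real \<alpha> * measure m (A n))"
        using A(3)[of n] by (simp add: emeasure_eq_ennreal_measure ennreal_mult ennreal_of_nat_eq_real_of_nat)
      finally have "real (card F) * (1 / real (Suc k)) \<le> real \<alpha> * measure m (A n)"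
        by (simp add: ennreal_le_iff del: of_nat_Suc)
      then have "real (card F) \<le> of_nat \<alpha> * measure m (A n) * real (Suc k)"
        by (simp add: field_simps del: of_nat_Suc)
      then show ?thesis unfolding c_def by linarith
    qed
    then show ?thesis using finite_if_finite_subsets_card_bdd by blast
  qed
  moreover have "{s \<in> I. B s \<notin> null_sets m} \<subseteq> (\<Union>n. \<Union>k. S n k)"
  proof
    fix s assume "s \<in> {s \<in> I. B s \<notin> null_sets m}"
    then have s: "s \<in> I" "B s \<notin> null_sets m" by auto
    have Bs: "B s \<in> sets m" by (rule assms(2)[OF s(1)])
    have "\<exists>n. emeasure m (B s \<inter> A n) \<noteq> 0"
    proof (rule ccontr)
      assume "\<not> ?thesis"
      then have "(\<Union>n. B s \<inter> A n) \<in> null_sets m"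
        using Bs A(1) by (intro null_sets_UN) (auto simp: null_sets_def)
      moreover have "(\<Union>n. B s \<inter> A n) = B s" using A(2) sets.sets_into_space[OF Bs] by blast
      ultimately show False using s(2) by simp
    qed
    then obtain n where n: "emeasure m (B s \<inter> A n) > 0" by (auto simp: zero_less_iff_neq_zero)
    have "(\<lambda>k. ennreal (1 / real (Suc k))) \<longlonglongrightarrow> ennreal 0"
      using LIMSEQ_inverse_real_of_nat by (intro tendsto_ennrealI) (simp add: inverse_eq_divide)
    then have "\<forall>\<^sub>F k in sequentially. ennreal (1 / real (Suc k)) < emeasure m (B s \<inter> A n)"
      using n by (intro order_tendstoD) simp_all
    then obtain k where "ennreal (1 / real (Suc k)) < emeasure m (B s \<inter> A n)"
      unfolding eventually_sequentially by blast
    then show "s \<in> (\<Union>n. \<Union>k. S n k)" using s(1) by (auto simp: S_def)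
  qed
  ultimately show ?thesis
    by (meson countable_UN countable_finite countable_subset countableI_type)
qed

theorem mainTheorem5:
  fixes X :: "rat_plus set"
    and m :: "'l::topological_space measure"
    and I :: "real set"
    and \<Phi> :: "'l \<times> real \<Rightarrow> mrds"
    and V :: "nat set"
    and E :: "(nat \<times> nat) set"
    and \<alpha> :: nat
  assumes "non_degenerate X"
    and "sets m = sets borel"
    and "sigma_finite_measure m"
    and "(\<exists>a b. a < b \<and> I = {a..<b}) \<or> (\<exists>a. I = {a..})"
    and "continuous_map (prod_topology euclidean (top_of_set I)) (mrds_topology X) \<Phi>"
    and "\<And>l s. s \<in> I \<Longrightarrow> mrds_graph (\<Phi> (l, s)) = (V, E)"
    and "\<And>e l s1 s2. e \<in> E \<Longrightarrow> s1 \<in> I \<Longrightarrow> s2 \<in> I \<Longrightarrow> s1 < s2 \<Longrightarrow>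
      edge_supp (\<Phi> (l, s1)) e \<subseteq> (top_of_set X) interior_of (edge_supp (\<Phi> (l, s2)) e)"
    and "\<And>l s. s \<in> I \<Longrightarrow> \<exists>L. attracting_minimal_set (\<Phi> (l, s)) L"
    and "\<And>l. finite {s \<in> I. \<not> mean_stable (\<Phi> (l, s))} \<and>
      card {s \<in> I. \<not> mean_stable (\<Phi> (l, s))} \<le> \<alpha>"
  shows "countable {s \<in> I. {l. \<not> mean_stable (\<Phi> (l, s))} \<notin> null_sets m}"
proof (rule countable_positive_bounded_overlap)
  show "sigma_finite_measure m" by fact
  show "{l. \<not> mean_stable (\<Phi> (l, s))} \<in> sets m" if "s \<in> I" for s
    unfolding assms(2) by (intro borel_closed closed_Bif[OF assms(5) that])
  \<comment> \<open>The parameters whose bifurcation set contains \<open>x\<close> form the fibre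
    Bif^x, so the assumed bound on fibres is exactly the overlap bound.\<close>
  show "finite {s \<in> I. x \<in> {l. \<not> mean_stable (\<Phi> (l, s))}} \<and>
      card {s \<in> I. x \<in> {l. \<not> mean_stable (\<Phi> (l, s))}} \<le> \<alpha>" for x
    using assms(9)[of x] by simp
qed

end
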